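(* For $\beta_4\in\mathbb R$ let $$\psi_{\mathrm{rb}\triangle}(\beta_4)=\sup_{\widetilde{\mathbf W}\in\widetilde{\mathcal W}_3}\Big\{\beta_4t_{\mathrm{rb}\triangle}(\mathbf W)-\tfrac12\mathcal I(\mathbf W)\Big\},\qquad \psi^{\mathrm{const}}_{\mathrm{rb}\triangle}(\beta_4)=\sup_{p\in\Delta_3}\Big\{\beta_4p_1p_2p_3-\tfrac12\sum_{i=1}^3p_i\log p_i\Big\}.$$ Then: (1) for $|\beta_4|<1$, $\psi_{\mathrm{rb}\triangle}(\beta_4)=\psi^{\mathrm{const}}_{\mathrm{rb}\triangle}(\beta_4)$; in fact, the maximizer in the definition of $\psi_{\mathrm{rb}\triangle}(\beta_4)$ is unique and is a constant graphon; (2) for $\beta_4>B_0$, $\psi_{\mathrm{rb}\triangle}(\beta_4)>\psi^{\mathrm{const}}_{\mathrm{rb}\triangle}(\beta_4)$, where $B_0=14.0049634433\ldots$ is the explicit constant $$B_0=\frac{\log3-\frac12\big(h(q_0)+h(s_0)\big)}{2\Delta_0},\qquad q_0=\tfrac{4491}{5000},\quad s_0=\tfrac{19}{10000},\quad \Delta_0=\tau(q_0,s_0)-\tfrac1{27},$$ with $h(u)=-u\log u-(1-u)\log\frac{1-u}2$ and $\tau(q,s)=\frac1{16}\big(q^3-2q^2+3qs^2-4qs+2q-2s^2+2s\big)$.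
   Context: $\Delta_3=\{\mu\in[0,1]^3:\mu_1+\mu_2+\mu_3=1\}$. A $3$-colored probability graphon is a measurable symmetric map $\mathbf W=(W_1,W_2,W_3):[0,1]^2\to\Delta_3$; $\mathcal W_3$ is the set of these. For bounded measurable $U$ on $[0,1]^2$, $\|U\|_\square=\sup_{S,T\subset[0,1]}|\int_{S\times T}U|$; $\|\mathbf U\|_\square=\sum_a\|U_a\|_\square$; $\delta_\square(\mathbf U,\mathbf W)=\inf_\phi\|\mathbf U-\mathbf W^\phi\|_\square$ over measure-preserving bijections $\phi$ of $[0,1]$, $\mathbf W^\phi(x,y)=\mathbf W(\phi(x),\phi(y))$. $\widetilde{\mathcal W}_3$ is the quotient of $\mathcal W_3$ by $\delta_\square=0$; the functionals below depend only on the class. $t_{\mathrm{rb}\triangle}(\mathbf W)=\int_{[0,1]^3}W_1(x,y)W_2(y,z)W_3(z,x)\,dx\,dy\,dz$; $\mathcal I(\mathbf W)=\sum_{a=1}^3\int_{[0,1]^2}W_a\log W_a\,dx\,dy$, $0\log0=0$. $\psi^{\mathrm{const}}_{\mathrm{rb}\triangle}(\beta_4)$ is the value of the variational problem restricted to constant graphons $\mathbf W\equiv p\in\Delta_3$. *)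

theory Defs
  imports "HOL-Analysis.Analysis"
begin

(* Colors are the elements 1, 2, 3 of the numeral type 3 (where 3 = 0), as in real^3. *)

definition simplex3 :: "(real^3) set" where
  "simplex3 = {\<mu>. (\<forall>a. 0 \<le> \<mu> $ a \<and> \<mu> $ a \<le> 1) \<and> \<mu> $ 1 + \<mu> $ 2 + \<mu> $ 3 = 1}"

abbreviation unit_square :: "(real \<times> real) set" where
  "unit_square \<equiv> {0..1} \<times> {0..1}"

abbreviation unit_cube :: "(real \<times> real \<times> real) set" where
  "unit_cube \<equiv> {0..1} \<times> {0..1} \<times> {0..1}"

(* Graphons are total functions of which only the values on the unit square matter:
   every notion below depends only on the restriction to the square. *)
definition prob_graphons3 :: "(real \<times> real \<Rightarrow> real^3) set" where
  "prob_graphons3 = {W. W \<in> borel_measurable (lebesgue_on unit_square)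
     \<and> (\<forall>x\<in>{0..1}. \<forall>y\<in>{0..1}. W (x, y) \<in> simplex3 \<and> W (x, y) = W (y, x))}"

definition cut_norm :: "(real \<times> real \<Rightarrow> real) \<Rightarrow> real" where
  "cut_norm U = (SUP (S, T) \<in> sets (lebesgue_on {0..1}) \<times> sets (lebesgue_on {0..1}).
      \<bar>set_lebesgue_integral lebesgue (S \<times> T) U\<bar>)"

definition cut_norm3 :: "(real \<times> real \<Rightarrow> real^3) \<Rightarrow> real" where
  "cut_norm3 U = (\<Sum>a\<in>UNIV. cut_norm (\<lambda>p. U p $ a))"

definition mp_bijections :: "(real \<Rightarrow> real) set" where
  "mp_bijections = {\<phi>. bij_betw \<phi> {0..1} {0..1}
     \<and> \<phi> \<in> lebesgue_on {0..1} \<rightarrow>\<^sub>M lebesgue_on {0..1}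
     \<and> distr (lebesgue_on {0..1}) (lebesgue_on {0..1}) \<phi> = lebesgue_on {0..1}}"

definition relabel :: "(real \<times> real \<Rightarrow> real^3) \<Rightarrow> (real \<Rightarrow> real) \<Rightarrow> real \<times> real \<Rightarrow> real^3" where
  "relabel W \<phi> = (\<lambda>(x, y). W (\<phi> x, \<phi> y))"

definition cut_dist3 :: "(real \<times> real \<Rightarrow> real^3) \<Rightarrow> (real \<times> real \<Rightarrow> real^3) \<Rightarrow> real" where
  "cut_dist3 U W = (INF \<phi>\<in>mp_bijections. cut_norm3 (\<lambda>p. U p - relabel W \<phi> p))"

definition cut_equiv3 ::
    "((real \<times> real \<Rightarrow> real^3) \<times> (real \<times> real \<Rightarrow> real^3)) set" where
  "cut_equiv3 = {(U, W). U \<in> prob_graphons3 \<and> W \<in> prob_graphons3 \<and> cut_dist3 U W = 0}"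

definition graphon_classes3 :: "(real \<times> real \<Rightarrow> real^3) set set" where
  "graphon_classes3 = prob_graphons3 // cut_equiv3"

definition t_rb :: "(real \<times> real \<Rightarrow> real^3) \<Rightarrow> real" where
  "t_rb W = set_lebesgue_integral lebesgue unit_cube
      (\<lambda>(x, y, z). W (x, y) $ 1 * W (y, z) $ 2 * W (z, x) $ 3)"

(* The convention 0 log 0 = 0 holds because of the factor 0. *)
definition entropy3 :: "(real \<times> real \<Rightarrow> real^3) \<Rightarrow> real" where
  "entropy3 W = (\<Sum>a\<in>UNIV. set_lebesgue_integral lebesgue unit_square
      (\<lambda>p. W p $ a * ln (W p $ a)))"

definition rb_functional :: "real \<Rightarrow> (real \<times> real \<Rightarrow> real^3) \<Rightarrow> real" where
  "rb_functional \<beta> W = \<beta> * t_rb W - 1/2 * entropy3 W"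

(* The functional depends only on the class of W; the supremum over classes C is written
   with the values at all representatives W of C. *)
definition psi_rb :: "real \<Rightarrow> real" where
  "psi_rb \<beta> = Sup {rb_functional \<beta> W | C W. C \<in> graphon_classes3 \<and> W \<in> C}"

definition psi_rb_const :: "real \<Rightarrow> real" where
  "psi_rb_const \<beta> = (SUP p\<in>simplex3.
      \<beta> * (p $ 1 * p $ 2 * p $ 3) - 1/2 * (\<Sum>i\<in>UNIV. p $ i * ln (p $ i)))"

(* A class on which the functional takes the value psi_rb. *)
definition is_rb_maximizer :: "real \<Rightarrow> (real \<times> real \<Rightarrow> real^3) set \<Rightarrow> bool" where
  "is_rb_maximizer \<beta> C \<longleftrightarrow> C \<in> graphon_classes3 \<and> rb_functional \<beta> ` C = {psi_rb \<beta>}"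

definition h_fun :: "real \<Rightarrow> real" where
  "h_fun u = - u * ln u - (1 - u) * ln ((1 - u) / 2)"

definition tau_fun :: "real \<Rightarrow> real \<Rightarrow> real" where
  "tau_fun q s = 1/16 * (q^3 - 2 * q^2 + 3 * q * s^2 - 4 * q * s + 2 * q - 2 * s^2 + 2 * s)"

definition q0 :: real where "q0 = 4491 / 5000"

definition s0 :: real where "s0 = 19 / 10000"

definition Delta0 :: real where "Delta0 = tau_fun q0 s0 - 1/27"

definition B0 :: real where
  "B0 = (ln 3 - 1/2 * (h_fun q0 + h_fun s0)) / (2 * Delta0)"

end

theory Submission
  imports Defs
begin

text \<open>
  Write \<open>W\<^sub>a = 1/3 + V\<^sub>a\<close>, so that \<open>V\<^sub>1 + V\<^sub>2 + V\<^sub>3 = 0\<close>, and let \<open>S = \<Sum>\<^sub>a \<integral> V\<^sub>a\<^sup>2\<close>. Expanding the triangle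
  density, the linear terms cancel, the quadratic ones are at most \<open>S/6\<close> in absolute value
  (after symmetrisation they equal \<open>-1/6 \<integral> \<Sum>\<^sub>a V\<^sub>a(x,y) V\<^sub>a(y,z)\<close>), and the cubic one is at most \<open>2S/9\<close>
  because \<open>\<bar>V\<^sub>a\<bar> \<le> 2/3\<close>; hence \<open>\<bar>t(W) - 1/27\<bar> \<le> 7S/18\<close>. On the other hand the pointwise bound
  \<open>w ln (3w) \<ge> (w - 1/3) + 7/9 (w - 1/3)\<^sup>2\<close> on \<open>[0,1]\<close> shows that the entropy term loses at least
  \<open>7S/18\<close>. For \<open>\<bar>\<beta>\<bar> < 1\<close> this forces \<open>S = 0\<close> at a maximiser. For \<open>\<beta> > B\<^sub>0\<close> a graphon with
  two blocks of equal size beats \<open>\<beta>/27 + (ln 3)/2\<close>, which bounds all constant graphons by AM-GM.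
\<close>

text \<open>The coefficient 7/9 is not the best possible in the pointwise bound; it is taken so that
  entropy loss and energy gain balance exactly at |beta| = 1. The two-block competitor is a softened
  version of two cliques of colour 1 whose cross edges are split evenly between colours 2 and 3.
  That extreme case, q = 1 and s = 0, has rainbow density 1/16 > 1/27; moving to (\<open>q0\<close>,
  \<open>s0\<close>) gives up some density for entropy, and this pair is nearly stationary for the
  quotient that defines \<open>B0\<close>. The number \<open>B0\<close> is the value of beta at
  which competitor and uniform graphon tie.

  The formal obstacles are measure-theoretic. Graphons and relabellings are only Lebesgue
  measurable, while Fubini arguments live on products of Borel measures, so every computation is
  done on a Borel version. Uniqueness is a statement about classes: it comes down to the fact that
  the class of the uniform graphon consists exactly of the graphons that are uniform almost
  everywhere.\<close>

section \<open>Pointwise inequalities\<close>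

text \<open>Dividing the difference of the two sides by u leaves \<open>g\<close>, whose derivative
  is rational and changes sign only at 1 and at 27/7 - 1 = 20/7. So \<open>g\<close> falls, rises
  and falls again, and on (0,3] it is smallest at 1, where it vanishes, or at 3, where ln 3 >= 82/81
  is enough.\<close>

lemma ln_ge_quadratic:
  fixes u :: real
  assumes "0 < u" "u \<le> 3"
  shows "(u - 1) + 7/27 * (u - 1)\<^sup>2 \<le> u * ln u"
proof -
  define g where "g u = ln u - (1 - 1/u) - 7/27 * (u - 2 + 1/u)" for u :: real
  have g1: "g 1 = 0" by (simp add: g_def)
  have der: "(g has_real_derivative (u - 1) * (1 - 7/27 * (u + 1)) / u\<^sup>2) (at u)" if "u > 0" for u
    unfolding g_def using that
    by (auto intro!: derivative_eq_intros simp: field_simps power2_eq_square power3_eq_cube)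
  have ln3: "g 3 \<ge> 0"
    using ln_approx_bounds[of 3 2] by (simp add: g_def eval_nat_numeral)
  have "g u \<ge> 0"
  proof -
    consider "u \<le> 1" | "1 < u" "u \<le> 20/7" | "20/7 < u" using assms by linarith
    then show ?thesis
    proof cases
      case 1
      have "g 1 \<le> g u"
      proof (rule DERIV_nonpos_imp_nonincreasing [OF 1])
        fix x assume "u \<le> x" "x \<le> 1"
        then show "\<exists>y. (g has_real_derivative y) (at x) \<and> y \<le> 0"
          using assms
            by (intro exI [where x = "(x - 1) * (1 - 7/27 * (x + 1)) / x\<^sup>2"])
              (use der [of x] in \<open>simp add: divide_nonpos_pos mult_nonpos_nonneg\<close>)
      qed
      then show ?thesis using g1 by simp
    next
      case 2
      have "g 1 \<le> g u"
      proof (rule DERIV_nonneg_imp_nondecreasing [of 1 u g])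
        show "1 \<le> u" using 2 by simp
      next
        fix x assume "1 \<le> x" "x \<le> u"
        then show "\<exists>y. (g has_real_derivative y) (at x) \<and> 0 \<le> y"
          using 2
            by (intro exI [where x = "(x - 1) * (1 - 7/27 * (x + 1)) / x\<^sup>2"])
              (use der [of x] in \<open>simp add: divide_nonneg_pos mult_nonneg_nonneg\<close>)
      qed
      then show ?thesis using g1 by simp
    next
      case 3
      have "g 3 \<le> g u"
      proof (rule DERIV_nonpos_imp_nonincreasing [OF assms(2)])
        fix x assume "u \<le> x" "x \<le> 3"
        then show "\<exists>y. (g has_real_derivative y) (at x) \<and> y \<le> 0"
          using 3
            by (intro exI [where x = "(x - 1) * (1 - 7/27 * (x + 1)) / x\<^sup>2"])
              (use der [of x] in \<open>simp add: divide_nonpos_pos mult_nonneg_nonpos\<close>)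
      qed
      then show ?thesis using ln3 by simp
    qed
  qed
  then have "0 \<le> u * g u" using assms by simp
  also have "u * g u = u * ln u - (u - 1) - 7/27 * (u - 1)\<^sup>2"
    using assms by (simp add: g_def field_simps power2_eq_square)
  finally show ?thesis by simp
qed

lemma mult_ln_ge_quadratic:
  fixes w :: real
  assumes "0 \<le> w" "w \<le> 1"
  shows "w * ln w \<ge> - ln 3 * w + (w - 1/3) + 7/9 * (w - 1/3)\<^sup>2"
proof (cases "w = 0")
  case True
  then show ?thesis by (simp add: power2_eq_square)
next
  case False
  then have "(3 * w - 1) + 7/27 * (3 * w - 1)\<^sup>2 \<le> 3 * w * ln (3 * w)"
    using assms by (intro ln_ge_quadratic) auto
  also have "ln (3 * w) = ln 3 + ln w"
    using assms False by (simp add: ln_mult)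
  finally have "(3 * w - 1) + 7/27 * (3 * w - 1)\<^sup>2 \<le> 3 * w * (ln 3 + ln w)" .
  moreover have "(3 * w - 1)\<^sup>2 = 9 * (w - 1/3)\<^sup>2"
    by (simp add: power2_eq_square algebra_simps)
  ultimately show ?thesis
    by (simp add: algebra_simps)
qed

lemma simplex3_entropy_ge:
  assumes "p \<in> simplex3"
  shows "(\<Sum>a\<in>UNIV. p $ a * ln (p $ a)) \<ge> - ln 3 + 7/9 * (\<Sum>a\<in>UNIV. (p $ a - 1/3)\<^sup>2)"
proof -
  have s: "p $ 1 + p $ 2 + p $ 3 = 1" and p: "\<And>a. 0 \<le> p $ a" "\<And>a. p $ a \<le> 1"
    using assms by (auto simp: simplex3_def)
  have "(\<Sum>a\<in>UNIV. p $ a * ln (p $ a))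
      \<ge> (\<Sum>a\<in>UNIV. - ln 3 * p $ a + (p $ a - 1/3) + 7/9 * (p $ a - 1/3)\<^sup>2)"
    by (rule sum_mono, rule mult_ln_ge_quadratic [OF p])
  also have "(\<Sum>a\<in>UNIV. - ln 3 * p $ a + (p $ a - 1/3) + 7/9 * (p $ a - 1/3)\<^sup>2)
      = - ln 3 * (p $ 1 + p $ 2 + p $ 3) + (p $ 1 + p $ 2 + p $ 3 - 1)
        + 7/9 * (\<Sum>a\<in>UNIV. (p $ a - 1/3)\<^sup>2)"
    by (simp add: sum_3 distrib_left)
  finally show ?thesis unfolding s by simp
qed

lemma simplex3_prod_le:
  assumes "p \<in> simplex3"
  shows "p $ 1 * p $ 2 * p $ 3 \<le> 1/27"
proof -
  define x y z where "x = p $ 1" and "y = p $ 2" and "z = p $ 3"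
  have nn: "x \<ge> 0" "y \<ge> 0" "z \<ge> 0" and z: "z = 1 - x - y"
    using assms by (auto simp: simplex3_def x_def y_def z_def)
  have "4 * (x * y) \<le> (x + y)\<^sup>2"
    using sum_squares_bound[of x y] by (simp add: power2_eq_square algebra_simps)
  then have "4 * (x * y) * z \<le> (x + y)\<^sup>2 * z"
    using nn by (intro mult_right_mono)
  also have "\<dots> = (1 - z)\<^sup>2 * z"
    by (simp add: z)
  \<comment> \<open>The maximum 4/27 is attained at z = 1/3, so the difference has a double root
    there; this determines the factorisation.\<close>
  also have "(1 - z)\<^sup>2 * z = 4/27 - (z - 1/3)\<^sup>2 * (4/3 - z)"
    by (simp add: power2_eq_square algebra_simps)
  also have "\<dots> \<le> 4/27"
    using nn z by simp
  finally show ?thesis by (simp add: x_def y_def z_def)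
qed

lemma abs_triple_prod_le:
  fixes a b c :: real
  assumes "\<bar>a\<bar> \<le> k" "\<bar>b\<bar> \<le> k" "\<bar>c\<bar> \<le> k"
  shows "\<bar>a * b * c\<bar> \<le> k / 3 * (a\<^sup>2 + b\<^sup>2 + c\<^sup>2)"
proof -
  have *: "\<bar>x\<bar> * \<bar>y\<bar> \<le> (x\<^sup>2 + y\<^sup>2) / 2" for x y :: real
    using sum_squares_bound[of "\<bar>x\<bar>" "\<bar>y\<bar>"] by simp
  \<comment> \<open>Each factor in turn is bounded by k and the other two by the mean of their
    squares; the average of the three estimates is symmetric.\<close>
  have "\<bar>a * b * c\<bar> \<le> k * ((b\<^sup>2 + c\<^sup>2) / 2)" "\<bar>b * a * c\<bar> \<le> k * ((a\<^sup>2 + c\<^sup>2) / 2)"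
    "\<bar>c * a * b\<bar> \<le> k * ((a\<^sup>2 + b\<^sup>2) / 2)"
    unfolding abs_mult mult.assoc using assms by (intro mult_mono * abs_ge_zero mult_nonneg_nonneg; simp)+
  then show ?thesis by (simp add: field_simps)
qed

section \<open>The uniform measure on the unit interval\<close>

text \<open>A density on \<open>lborel\<close> rather than \<open>lebesgue_on {0..1}\<close>: the
  space is all of the line and the sigma-algebra is Borel, so products are again Borel and
  measurability needs no restriction to the square or the cube.\<close>

definition unit_meas :: "real measure" where
  "unit_meas = density lborel (indicator {0..1})"

abbreviation unit_meas2 :: "(real \<times> real) measure" where
  "unit_meas2 \<equiv> unit_meas \<Otimes>\<^sub>M unit_meas"

abbreviation unit_meas3 :: "(real \<times> real \<times> real) measure" where
  "unit_meas3 \<equiv> unit_meas \<Otimes>\<^sub>M unit_meas2"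

lemma space_unit_meas [simp]: "space unit_meas = UNIV"
  by (simp add: unit_meas_def)

lemma sets_unit_meas [measurable_cong]: "sets unit_meas = sets borel"
  by (simp add: unit_meas_def)

lemma emeasure_unit_meas_UNIV [simp]: "emeasure unit_meas UNIV = 1"
  by (simp add: unit_meas_def emeasure_density)

lemma emeasure_unit_meas:
  "A \<in> sets borel \<Longrightarrow> emeasure unit_meas A = emeasure lborel ({0..1} \<inter> A)"
  unfolding unit_meas_def by (subst emeasure_density) (simp_all flip: indicator_inter_arith)

interpretation unit: finite_measure unit_meas
  by (rule finite_measureI) simp

interpretation unit2: pair_sigma_finite unit_meas unit_meas ..

interpretation unit2: finite_measure unit_meas2
  by (rule finite_measure_pair_measure) unfold_locales

interpretation unit3: pair_sigma_finite unit_meas unit_meas2 ..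

interpretation unit3: finite_measure unit_meas3
  by (rule finite_measure_pair_measure) unfold_locales

lemma space_unit_meas2 [simp]: "space unit_meas2 = UNIV"
  by (simp add: space_pair_measure)

lemma space_unit_meas3 [simp]: "space unit_meas3 = UNIV"
  by (simp add: space_pair_measure)

lemma sets_unit_meas2: "sets unit_meas2 = sets borel"
  unfolding borel_prod [symmetric] by (intro sets_pair_measure_cong sets_unit_meas)

lemma measure_unit_meas2_UNIV [simp]: "measure unit_meas2 UNIV = 1"
  using unit.emeasure_pair_measure_Times[of UNIV unit_meas UNIV]
  by (simp add: sets_unit_meas measure_def)

lemma measure_unit_meas3_UNIV [simp]: "measure unit_meas3 UNIV = 1"
proof -
  have "emeasure unit_meas3 (UNIV \<times> UNIV) = emeasure unit_meas UNIV * emeasure unit_meas2 UNIV"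
    using sets.top[of unit_meas] sets.top[of unit_meas2]
    by (intro unit2.emeasure_pair_measure_Times) simp_all
  moreover have "emeasure unit_meas2 UNIV = 1"
    using unit.emeasure_pair_measure_Times[of UNIV unit_meas UNIV] by (simp add: sets_unit_meas)
  ultimately show ?thesis by (simp add: measure_def)
qed

lemma unit_meas2_eq: "unit_meas2 = density lborel (indicator unit_square)"
proof -
  have "unit_meas2 = density (lborel \<Otimes>\<^sub>M lborel) (\<lambda>(x, y). indicator {0..1} x * indicator {0..1} y)"
    unfolding unit_meas_def
    by (rule pair_measure_density) (use unit.sigma_finite_measure_axioms in \<open>simp_all add: unit_meas_def sigma_finite_lborel\<close>)
  also have "(\<lambda>(x::real, y::real). indicator {0..1} x * indicator {0..1} y :: ennreal) = indicator unit_square"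
    by (auto simp: fun_eq_iff split: split_indicator)
  finally show ?thesis by (simp add: lborel_prod)
qed

lemma unit_meas3_eq: "unit_meas3 = density lborel (indicator unit_cube)"
proof -
  have "unit_meas3 = density (lborel \<Otimes>\<^sub>M lborel) (\<lambda>(x, p). indicator {0..1} x * indicator unit_square p)"
    unfolding unit_meas2_eq unfolding unit_meas_def
    by (rule pair_measure_density)
      (use unit2.sigma_finite_measure_axioms in \<open>simp_all add: unit_meas2_eq sigma_finite_lborel borel_measurable_indicator borel_Times\<close>)
  also have "(\<lambda>(x::real, p::real\<times>real). indicator {0..1} x * indicator unit_square p :: ennreal) = indicator unit_cube"
    by (auto simp: fun_eq_iff split: split_indicator)
  finally show ?thesis by (simp add: lborel_prod)
qed

section \<open>Lebesgue integrals computed through Borel versions\<close>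

lemma measurable_completion_AE:
  assumes g: "g \<in> completion M \<rightarrow>\<^sub>M N" and ae: "AE x in M. f x = g x"
    and f: "\<And>x. x \<in> space M \<Longrightarrow> f x \<in> space N"
  shows "f \<in> completion M \<rightarrow>\<^sub>M N"
proof (rule measurableI)
  fix B assume "B \<in> sets N"
  then have "g -` B \<inter> space (completion M) \<in> sets (completion M)"
    using g by (rule measurable_sets[rotated])
  then show "f -` B \<inter> space (completion M) \<in> sets (completion M)"
    by (rule completion.in_sets_AE [rotated]) (use AE_completion[OF ae] in auto)
qed (use f in simp)

text \<open>The bridge from the definitions to \<open>unit_meas2\<close> and
  \<open>unit_meas3\<close>. No measurability of f is assumed: a completed measure makes every
  function measurable that agrees almost everywhere with a measurable one.\<close>

lemma set_integral_lebesgue_eq: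
  fixes f g :: "'a::euclidean_space \<Rightarrow> real"
  assumes A: "A \<in> sets borel" and g: "g \<in> borel_measurable borel"
    and ae: "AE x in density lborel (indicator A). f x = g x"
  shows "set_lebesgue_integral lebesgue A f = (\<integral>x. g x \<partial>density lborel (indicator A))"
proof -
  have meas: "(\<lambda>x. indicator A x *\<^sub>R g x) \<in> borel_measurable borel"
    using A g by measurable
  have ae': "AE x in lborel. indicator A x *\<^sub>R f x = indicator A x *\<^sub>R g x"
    using ae A by (subst (asm) AE_density) (auto split: split_indicator elim!: eventually_mono)
  have "set_lebesgue_integral lebesgue A f = (\<integral>x. indicator A x *\<^sub>R g x \<partial>lebesgue)"
    unfolding set_lebesgue_integral_def
    by (intro integral_cong_AE AE_completion ae' measurable_completion_AE [OF _ ae'] measurable_completion)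
      (use meas in simp_all)
  also have "\<dots> = (\<integral>x. indicator A x *\<^sub>R g x \<partial>lborel)"
    by (rule integral_completion) (use meas in simp)
  also have "\<dots> = (\<integral>x. g x \<partial>density lborel (\<lambda>x. ennreal (indicator A x)))"
    using A g by (subst integral_density) auto
  finally show ?thesis by (simp add: ennreal_indicator)
qed

lemma nn_integral_unit_meas3:
  assumes "f \<in> borel_measurable unit_meas3"
  shows "(\<integral>\<^sup>+p. f p \<partial>unit_meas3) = (\<integral>\<^sup>+x. \<integral>\<^sup>+y. \<integral>\<^sup>+z. f (x, y, z) \<partial>unit_meas \<partial>unit_meas \<partial>unit_meas)"
proof -
  note [measurable] = assms
  have "(\<integral>\<^sup>+p. f p \<partial>unit_meas3) = (\<integral>\<^sup>+x. \<integral>\<^sup>+p. f (x, p) \<partial>unit_meas2 \<partial>unit_meas)"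
    by (simp add: unit2.nn_integral_fst)
  also have "\<dots> = (\<integral>\<^sup>+x. \<integral>\<^sup>+y. \<integral>\<^sup>+z. f (x, y, z) \<partial>unit_meas \<partial>unit_meas \<partial>unit_meas)"
    by (intro nn_integral_cong unit.nn_integral_fst [symmetric]) simp
  finally show ?thesis .
qed

section \<open>Permutations of the three vertices\<close>

lemma distr_unit_meas3_swap12: "distr unit_meas3 unit_meas3 (\<lambda>(x, y, z). (y, x, z)) = unit_meas3"
proof (rule measure_eqI)
  fix A assume "A \<in> sets (distr unit_meas3 unit_meas3 (\<lambda>(x, y, z). (y, x, z)))"
  then have [measurable]: "A \<in> sets unit_meas3" by simp
  have "emeasure (distr unit_meas3 unit_meas3 (\<lambda>(x, y, z). (y, x, z))) A
    = (\<integral>\<^sup>+p. indicator A p \<partial>distr unit_meas3 unit_meas3 (\<lambda>(x, y, z). (y, x, z)))"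
    by simp
  also have "\<dots> = (\<integral>\<^sup>+p. indicator A (case p of (x, y, z) \<Rightarrow> (y, x, z)) \<partial>unit_meas3)"
    by (subst nn_integral_distr) simp_all
  also have "\<dots> = (\<integral>\<^sup>+x. \<integral>\<^sup>+y. \<integral>\<^sup>+z. indicator A (y, x, z) \<partial>unit_meas \<partial>unit_meas \<partial>unit_meas)"
    by (subst nn_integral_unit_meas3) simp_all
  also have "\<dots> = (\<integral>\<^sup>+y. \<integral>\<^sup>+x. \<integral>\<^sup>+z. indicator A (y, x, z) \<partial>unit_meas \<partial>unit_meas \<partial>unit_meas)"
    by (rule unit2.Fubini') measurable
  also have "\<dots> = emeasure unit_meas3 A"
    by (subst nn_integral_unit_meas3 [symmetric]) simp_all
  finally show "emeasure (distr unit_meas3 unit_meas3 (\<lambda>(x, y, z). (y, x, z))) A = emeasure unit_meas3 A" .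
qed simp

lemma distr_unit_meas3_swap23: "distr unit_meas3 unit_meas3 (\<lambda>(x, y, z). (x, z, y)) = unit_meas3"
proof (rule measure_eqI)
  fix A assume "A \<in> sets (distr unit_meas3 unit_meas3 (\<lambda>(x, y, z). (x, z, y)))"
  then have [measurable]: "A \<in> sets unit_meas3" by simp
  have "emeasure (distr unit_meas3 unit_meas3 (\<lambda>(x, y, z). (x, z, y))) A
    = (\<integral>\<^sup>+p. indicator A p \<partial>distr unit_meas3 unit_meas3 (\<lambda>(x, y, z). (x, z, y)))"
    by simp
  also have "\<dots> = (\<integral>\<^sup>+p. indicator A (case p of (x, y, z) \<Rightarrow> (x, z, y)) \<partial>unit_meas3)"
    by (subst nn_integral_distr) simp_all
  also have "\<dots> = (\<integral>\<^sup>+x. \<integral>\<^sup>+y. \<integral>\<^sup>+z. indicator A (x, z, y) \<partial>unit_meas \<partial>unit_meas \<partial>unit_meas)"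
    by (subst nn_integral_unit_meas3) simp_all
  also have "\<dots> = (\<integral>\<^sup>+x. \<integral>\<^sup>+z. \<integral>\<^sup>+y. indicator A (x, z, y) \<partial>unit_meas \<partial>unit_meas \<partial>unit_meas)"
    by (intro nn_integral_cong unit2.Fubini') measurable
  also have "\<dots> = emeasure unit_meas3 A"
    by (subst nn_integral_unit_meas3 [symmetric]) simp_all
  finally show "emeasure (distr unit_meas3 unit_meas3 (\<lambda>(x, y, z). (x, z, y))) A = emeasure unit_meas3 A" .
qed simp

text \<open>A rotation is a product of two adjacent transpositions. It carries the edges (x,y),
  (y,z), (z,x) of the triangle cyclically into each other.\<close>

lemma distr_unit_meas3_rotate: "distr unit_meas3 unit_meas3 (\<lambda>(x, y, z). (y, z, x)) = unit_meas3"
proof -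
  have "distr (distr unit_meas3 unit_meas3 (\<lambda>(x, y, z). (y, x, z))) unit_meas3 (\<lambda>(x, y, z). (x, z, y))
    = distr unit_meas3 unit_meas3 (\<lambda>(x, y, z). (y, z, x))"
    by (subst distr_distr) (auto intro!: distr_cong)
  then show ?thesis
    by (simp add: distr_unit_meas3_swap12 distr_unit_meas3_swap23)
qed

lemma distr_unit_meas3_snd: "distr unit_meas3 unit_meas2 snd = unit_meas2"
proof (rule measure_eqI)
  fix A assume "A \<in> sets (distr unit_meas3 unit_meas2 snd)"
  then have A: "A \<in> sets unit_meas2" by simp
  have "emeasure (distr unit_meas3 unit_meas2 snd) A = emeasure unit_meas3 (UNIV \<times> A)"
    by (subst emeasure_distr) (use A in \<open>auto intro!: arg_cong[where f = "emeasure _"]\<close>)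
  also have "\<dots> = emeasure unit_meas2 A"
    by (subst unit2.emeasure_pair_measure_Times) (use A in \<open>auto simp: sets_unit_meas\<close>)
  finally show "emeasure (distr unit_meas3 unit_meas2 snd) A = emeasure unit_meas2 A" .
qed simp

section \<open>Borel versions of graphons\<close>

lemma borel_measurable_vec_iff:
  fixes f :: "'a \<Rightarrow> real^'n"
  shows "f \<in> borel_measurable M \<longleftrightarrow> (\<forall>a. (\<lambda>x. f x $ a) \<in> borel_measurable M)"
  by (subst borel_measurable_euclidean_space) (auto simp: Basis_vec_def inner_axis)

lemma AE_unit_meas2_iff: "(AE p in unit_meas2. P p) \<longleftrightarrow> (AE p in lborel. p \<in> unit_square \<longrightarrow> P p)"
proof -
  have "(indicator unit_square :: _ \<Rightarrow> ennreal) \<in> borel_measurable lborel"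
    by (intro borel_measurable_indicator) (simp add: borel_Times)
  then show ?thesis
    unfolding unit_meas2_eq
    by (subst AE_density) (auto simp: indicator_def intro!: AE_cong)
qed

lemma simplex3_third: "(\<chi> a. 1/3) \<in> simplex3"
  by (simp add: simplex3_def)

text \<open>Changing W on a null set yields a map that is Borel, simplex-valued and symmetric at
  every point of the plane, so that the later algebra is free of exceptional sets.\<close>

lemma prob_graphons3_borel_version:
  assumes W: "W \<in> prob_graphons3"
  obtains V where "V \<in> borel_measurable borel" "\<And>p. V p \<in> simplex3"
    "\<And>x y. V (x, y) = V (y, x)" "AE p in unit_meas2. W p = V p"
proof -
  have W_meas: "W \<in> borel_measurable (lebesgue_on unit_square)"
    and W_simplex: "\<And>x y. x \<in> {0..1} \<Longrightarrow> y \<in> {0..1} \<Longrightarrow> W (x, y) \<in> simplex3"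
    and W_sym: "\<And>x y. x \<in> {0..1} \<Longrightarrow> y \<in> {0..1} \<Longrightarrow> W (x, y) = W (y, x)"
    using W by (auto simp: prob_graphons3_def)
  have "\<exists>g\<in>borel_measurable lborel. AE p in lborel. (if p \<in> unit_square then W p $ a else 0) = g p" for a
  proof (rule completion_ex_borel_measurable_real)
    have "(\<lambda>p. W p $ a) \<in> borel_measurable (lebesgue_on unit_square)"
      using W_meas by (simp add: borel_measurable_vec_iff)
    then show "(\<lambda>p. if p \<in> unit_square then W p $ a else 0) \<in> borel_measurable lebesgue"
      by (subst borel_measurable_if) (auto simp: borel_Times)
  qed
  then have "\<forall>a. \<exists>g. g \<in> borel_measurable borel \<and>
      (AE p in lborel. (if p \<in> unit_square then W p $ a else 0) = g p)"
    by (simp add: Bex_def)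
  from choice [OF this] obtain g where g [measurable]: "\<And>a. g a \<in> borel_measurable borel"
    and ae: "\<And>a. AE p in lborel. (if p \<in> unit_square then W p $ a else 0) = g a p"
    by blast
  have "AE p in lborel. \<forall>a. (if p \<in> unit_square then W p $ a else 0) = g a p"
    using ae by (simp only: AE_all_countable) simp
  then have "AE p in unit_meas2. \<forall>a. W p $ a = g a p"
    unfolding AE_unit_meas2_iff by (rule eventually_mono) (metis (full_types))
  then have "AE p in unit_meas2. W p = (\<chi> a. g a p)"
    by (simp add: vec_eq_iff)
  then obtain N where N: "N \<in> null_sets unit_meas2" "{p. W p \<noteq> (\<chi> a. g a p)} \<subseteq> N"
    by (auto elim!: AE_E simp: null_sets_def)
  \<comment> \<open>Removing the transpose of N as well keeps G symmetric; the transpose is null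
    because swapping coordinates preserves the product measure.\<close>
  define G where "G = unit_square - N - (\<lambda>(x, y). (y, x)) -` N"
  have N_meas [measurable]: "N \<in> sets borel"
    using N(1) by (auto simp: null_sets_def sets_unit_meas2)
  \<comment> \<open>Off G the uniform colouring serves as default: it is constant, hence symmetric,
    and lies in the simplex.\<close>
  define V where "V p = (if p \<in> G then \<chi> a. g a p else \<chi> a. 1/3)" for p
  have G_W: "V p = W p" if "p \<in> G" for p
  proof -
    have "W p = (\<chi> a. g a p)"
      using that N(2) unfolding G_def by blast
    with that show ?thesis by (simp add: V_def)
  qed
  show thesis
  proof
    have "(\<lambda>(x, y). (y, x)) \<in> (borel :: (real \<times> real) measure) \<rightarrow>\<^sub>M borel"
      unfolding borel_prod [symmetric] by measurable
    from measurable_sets [OF this N_meas] have [measurable]: "G \<in> sets borel"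
      unfolding G_def by (intro sets.Diff) (simp_all add: borel_Times)
    show "V \<in> borel_measurable borel"
      unfolding V_def borel_measurable_vec_iff if_distrib [of "\<lambda>v. v $ _"] vec_lambda_beta by measurable
    show "V p \<in> simplex3" for p
      by (cases "p \<in> G") (use G_W W_simplex simplex3_third in \<open>auto simp: G_def V_def\<close>)
    show "V (x, y) = V (y, x)" for x y
    proof (cases "(x, y) \<in> G")
      case True
      then have "(y, x) \<in> G" by (auto simp: G_def)
      with True show ?thesis
        using W_sym[of x y] by (simp add: G_W) (auto simp: G_def)
    next
      case False
      then have "(y, x) \<notin> G" by (auto simp: G_def)
      with False show ?thesis by (simp add: V_def)
    qed
    have "AE p in unit_meas2. p \<notin> N"
      using N(1) by (rule AE_not_in)
    moreover have "AE p in unit_meas2. (case p of (x, y) \<Rightarrow> (y, x)) \<notin> N"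
    proof (rule AE_distrD [where M' = unit_meas2])
      show "AE p in distr unit_meas2 unit_meas2 (\<lambda>(x, y). (y, x)). p \<notin> N"
        using AE_not_in[OF N(1)] by (simp only: unit2.distr_pair_swap [symmetric])
    qed simp
    moreover have "AE p in unit_meas2. p \<in> unit_square"
      unfolding AE_unit_meas2_iff by simp
    ultimately show "AE p in unit_meas2. W p = V p"
      by eventually_elim (simp add: G_W G_def)
  qed
qed

lemma entropy3_eq:
  assumes V: "V \<in> borel_measurable borel" and ae: "AE p in unit_meas2. W p = V p"
  shows "entropy3 W = (\<Sum>a\<in>UNIV. \<integral>p. V p $ a * ln (V p $ a) \<partial>unit_meas2)"
  unfolding entropy3_def unit_meas2_eq
proof (intro sum.cong refl set_integral_lebesgue_eq)
  have [measurable]: "(\<lambda>p. V p $ a) \<in> borel_measurable borel" for a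
    using V by (simp add: borel_measurable_vec_iff)
  show "(\<lambda>p. V p $ a * ln (V p $ a)) \<in> borel_measurable borel" for a
    by measurable
  show "AE p in density lborel (indicator unit_square). W p $ a * ln (W p $ a) = V p $ a * ln (V p $ a)" for a
    using ae unfolding unit_meas2_eq by eventually_elim simp
qed (simp add: borel_Times)

text \<open>Null sets of the square pull back to null sets of the cube along each edge:
  \<open>snd\<close> preserves measure, and the other two edges are \<open>snd\<close> after a power
  of the rotation.\<close>

lemma AE_unit_meas3:
  assumes "AE p in unit_meas2. P p"
  shows "AE (x, y, z) in unit_meas3. P (x, y)" "AE (x, y, z) in unit_meas3. P (y, z)"
    "AE (x, y, z) in unit_meas3. P (z, x)"
proof -
  have *: "AE p in unit_meas3. P (snd (f p))"
    if "distr unit_meas3 unit_meas3 f = unit_meas3" "f \<in> unit_meas3 \<rightarrow>\<^sub>M unit_meas3" for f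
  proof (rule AE_distrD [where f = f and M' = unit_meas3 and P = "\<lambda>p. P (snd p)"])
    have "AE p in distr unit_meas3 unit_meas2 snd. P p"
      using assms by (simp only: distr_unit_meas3_snd)
    then have "AE p in unit_meas3. P (snd p)"
      by (rule AE_distrD [rotated]) simp
    then show "AE p in distr unit_meas3 unit_meas3 f. P (snd p)"
      by (simp only: that)
  qed (rule that)
  show "AE (x, y, z) in unit_meas3. P (y, z)"
    using *[of "\<lambda>p. p"] by (simp add: case_prod_beta' distr_id)
  show "AE (x, y, z) in unit_meas3. P (z, x)"
    using *[OF distr_unit_meas3_rotate] by (simp add: case_prod_beta')
  have "distr (distr unit_meas3 unit_meas3 (\<lambda>(x, y, z). (y, z, x))) unit_meas3 (\<lambda>(x, y, z). (y, z, x))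
    = distr unit_meas3 unit_meas3 (\<lambda>(x, y, z). (z, x, y))"
    by (subst distr_distr) (auto intro!: distr_cong)
  then show "AE (x, y, z) in unit_meas3. P (x, y)"
    using *[of "\<lambda>(x, y, z). (z, x, y)"] by (simp add: distr_unit_meas3_rotate) (simp add: case_prod_beta')
qed

lemma t_rb_eq:
  assumes V: "V \<in> borel_measurable borel" and ae: "AE p in unit_meas2. W p = V p"
  shows "t_rb W = (\<integral>(x, y, z). V (x, y) $ 1 * V (y, z) $ 2 * V (z, x) $ 3 \<partial>unit_meas3)"
  unfolding t_rb_def unit_meas3_eq
proof (rule set_integral_lebesgue_eq)
  have "(\<lambda>p. V p $ a) \<in> borel_measurable (borel \<Otimes>\<^sub>M borel)" for a
    using V by (simp add: borel_prod borel_measurable_vec_iff)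
  note [measurable] = this
  show "(\<lambda>(x, y, z). V (x, y) $ 1 * V (y, z) $ 2 * V (z, x) $ 3) \<in> borel_measurable borel"
    unfolding borel_prod [symmetric] by measurable
  show "AE p in density lborel (indicator unit_cube).
      (case p of (x, y, z) \<Rightarrow> W (x, y) $ 1 * W (y, z) $ 2 * W (z, x) $ 3)
    = (case p of (x, y, z) \<Rightarrow> V (x, y) $ 1 * V (y, z) $ 2 * V (z, x) $ 3)"
    using AE_unit_meas3 [OF ae] unfolding unit_meas3_eq by eventually_elim (auto simp: case_prod_beta')
qed (simp add: borel_Times)

section \<open>Expansion around the uniform colouring\<close>

lemma integral_unit_meas3_snd:
  fixes f :: "real \<times> real \<Rightarrow> real"
  assumes [measurable]: "f \<in> borel_measurable unit_meas2"
  shows "(\<integral>(x, y, z). f (y, z) \<partial>unit_meas3) = (\<integral>p. f p \<partial>unit_meas2)"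
  by (subst (2) distr_unit_meas3_snd [symmetric]) (simp add: integral_distr case_prod_beta')

lemma integral_unit_meas3_rotate:
  fixes f :: "real \<times> real \<times> real \<Rightarrow> real"
  assumes [measurable]: "f \<in> borel_measurable unit_meas3"
  shows "(\<integral>(x, y, z). f (y, z, x) \<partial>unit_meas3) = (\<integral>p. f p \<partial>unit_meas3)"
  by (subst (2) distr_unit_meas3_rotate [symmetric]) (simp add: integral_distr case_prod_beta')

lemma integral_unit_meas3_swap12:
  fixes f :: "real \<times> real \<times> real \<Rightarrow> real"
  assumes [measurable]: "f \<in> borel_measurable unit_meas3"
  shows "(\<integral>(x, y, z). f (y, x, z) \<partial>unit_meas3) = (\<integral>p. f p \<partial>unit_meas3)"
  by (subst (2) distr_unit_meas3_swap12 [symmetric]) (simp add: integral_distr case_prod_beta')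

lemma integral_unit_meas3_pairs:
  fixes f :: "real \<times> real \<Rightarrow> real"
  assumes [measurable]: "f \<in> borel_measurable unit_meas2"
  shows "(\<integral>(x, y, z). f (z, x) \<partial>unit_meas3) = (\<integral>p. f p \<partial>unit_meas2)"
    and "(\<integral>(x, y, z). f (x, y) \<partial>unit_meas3) = (\<integral>p. f p \<partial>unit_meas2)"
proof -
  show zx: "(\<integral>(x, y, z). f (z, x) \<partial>unit_meas3) = (\<integral>p. f p \<partial>unit_meas2)"
    using integral_unit_meas3_rotate[of "\<lambda>(x, y, z). f (y, z)"]
    unfolding prod.case integral_unit_meas3_snd [OF assms] by measurable
  show "(\<integral>(x, y, z). f (x, y) \<partial>unit_meas3) = (\<integral>p. f p \<partial>unit_meas2)"
    using integral_unit_meas3_rotate[of "\<lambda>(x, y, z). f (z, x)"]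
    unfolding prod.case zx by measurable
qed

lemma simplex3_deviation:
  assumes "p \<in> simplex3"
  shows "\<bar>p $ a - 1/3\<bar> \<le> 2/3" "(p $ 1 - 1/3) + (p $ 2 - 1/3) + (p $ 3 - 1/3) = 0"
proof -
  have nn: "0 \<le> p $ a" "p $ a \<le> 1" and s: "p $ 1 + p $ 2 + p $ 3 = 1"
    using assms by (auto simp: simplex3_def)
  show "\<bar>p $ a - 1/3\<bar> \<le> 2/3" using nn by linarith
  show "(p $ 1 - 1/3) + (p $ 2 - 1/3) + (p $ 3 - 1/3) = 0" using s by simp
qed

locale symmetric_simplex_map =
  fixes V :: "real \<times> real \<Rightarrow> real^3"
  assumes borel: "V \<in> borel_measurable borel"
    and simplex: "V p \<in> simplex3"
    and sym: "V (x, y) = V (y, x)"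
begin

definition dev :: "3 \<Rightarrow> real \<times> real \<Rightarrow> real" where
  "dev a p = V p $ a - 1/3"

text \<open>The quantity S of the overview; it is the witness v of
  \<open>rb_functional_le\<close>.\<close>

definition var :: real where
  "var = (\<integral>p. (\<Sum>a\<in>UNIV. (dev a p)\<^sup>2) \<partial>unit_meas2)"

lemma nth_measurable [measurable]: "(\<lambda>p. V p $ a) \<in> borel_measurable (borel \<Otimes>\<^sub>M borel)"
  using borel by (simp add: borel_prod borel_measurable_vec_iff)

lemma dev_measurable [measurable]: "dev a \<in> borel_measurable (borel \<Otimes>\<^sub>M borel)"
  unfolding dev_def [abs_def] by measurable

lemma abs_dev_le: "\<bar>dev a p\<bar> \<le> 2/3"
  unfolding dev_def by (rule simplex3_deviation [OF simplex])

lemma sum_dev: "dev 1 p + dev 2 p + dev 3 p = 0"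
  unfolding dev_def by (rule simplex3_deviation [OF simplex])

lemma dev_sym: "dev a (x, y) = dev a (y, x)"
  unfolding dev_def by (subst sym) simp

lemma integrable_dev: "integrable unit_meas2 (dev a)"
  by (rule unit2.integrable_const_bound [of _ "2/3"], simp only: real_norm_def abs_dev_le AE_I2, measurable)

lemma dev_sq_le: "(dev a p)\<^sup>2 \<le> 4/9"
  using power_mono [OF abs_dev_le abs_ge_zero, of a p 2] by (simp add: power2_eq_square)

lemma integrable_dev_sq: "integrable unit_meas2 (\<lambda>p. (dev a p)\<^sup>2)"
  by (rule unit2.integrable_const_bound [of _ "4/9"], simp only: real_norm_def abs_power2 dev_sq_le AE_I2, measurable)

lemma var_eq: "var = (\<integral>p. (dev 1 p)\<^sup>2 \<partial>unit_meas2) + (\<integral>p. (dev 2 p)\<^sup>2 \<partial>unit_meas2) + (\<integral>p. (dev 3 p)\<^sup>2 \<partial>unit_meas2)"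
  unfolding var_def by (simp add: sum_3 integrable_dev_sq)

lemma var_nonneg: "var \<ge> 0"
  unfolding var_def by (intro integral_nonneg_AE AE_I2 sum_nonneg) simp

lemma integrable_dev_mult:
  assumes [measurable]: "f \<in> unit_meas3 \<rightarrow>\<^sub>M borel \<Otimes>\<^sub>M borel" "g \<in> unit_meas3 \<rightarrow>\<^sub>M borel \<Otimes>\<^sub>M borel"
  shows "integrable unit_meas3 (\<lambda>p. dev a (f p) * dev b (g p))"
proof (rule unit3.integrable_const_bound [of _ "2/3 * (2/3)"])
  show "AE p in unit_meas3. norm (dev a (f p) * dev b (g p)) \<le> 2/3 * (2/3)"
    unfolding real_norm_def abs_mult by (intro AE_I2 mult_mono abs_dev_le) auto
qed simp

text \<open>The density of a two-edge path with middle vertex y, weighted by the deviations of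
  colour a and colour b. The quadratic terms of the triangle expansion are of this form up to a
  rotation.\<close>

definition cherry :: "3 \<Rightarrow> 3 \<Rightarrow> real" where
  "cherry a b = (\<integral>(x, y, z). dev a (x, y) * dev b (y, z) \<partial>unit_meas3)"

lemma cherry_rotations:
  "(\<integral>(x, y, z). dev a (y, z) * dev b (z, x) \<partial>unit_meas3) = cherry a b"
  "(\<integral>(x, y, z). dev a (z, x) * dev b (x, y) \<partial>unit_meas3) = cherry a b"
proof -
  show r: "(\<integral>(x, y, z). dev a (y, z) * dev b (z, x) \<partial>unit_meas3) = cherry a b"
    unfolding cherry_def
    using integral_unit_meas3_rotate[of "\<lambda>(x, y, z). dev a (x, y) * dev b (y, z)"] by simp
  show "(\<integral>(x, y, z). dev a (z, x) * dev b (x, y) \<partial>unit_meas3) = cherry a b"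
    unfolding r [symmetric]
    using integral_unit_meas3_rotate[of "\<lambda>(x, y, z). dev a (y, z) * dev b (z, x)"] by simp
qed

lemma cherry_commute: "cherry a b = cherry b a"
proof -
  \<comment> \<open>With the middle vertex first rotated to x, exchanging x and y produces the path
    traversed backwards.\<close>
  have "cherry a b = (\<integral>(x, y, z). dev a (z, y) * dev b (y, x) \<partial>unit_meas3)"
    unfolding cherry_rotations(2) [of a b, symmetric]
    using integral_unit_meas3_swap12[of "\<lambda>(x, y, z). dev a (z, x) * dev b (x, y)"] by simp
  also have "\<dots> = cherry b a"
    unfolding cherry_def by (subst dev_sym, subst (2) dev_sym) (simp add: mult.commute)
  finally show ?thesis .
qed

lemma abs_cherry_self_le: "\<bar>cherry a a\<bar> \<le> (\<integral>p. (dev a p)\<^sup>2 \<partial>unit_meas2)"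
proof -
  have int: "integrable unit_meas3 (\<lambda>(x, y, z). (dev a (x, y))\<^sup>2)"
    "integrable unit_meas3 (\<lambda>(x, y, z). (dev a (y, z))\<^sup>2)"
    using integrable_dev_mult[of "\<lambda>(x, y, z). (x, y)" "\<lambda>(x, y, z). (x, y)" a a]
      integrable_dev_mult[of "\<lambda>(x, y, z). (y, z)" "\<lambda>(x, y, z). (y, z)" a a]
    by (simp_all add: case_prod_beta' power2_eq_square)
  have "\<bar>cherry a a\<bar> \<le> (\<integral>(x, y, z). \<bar>dev a (x, y) * dev a (y, z)\<bar> \<partial>unit_meas3)"
    unfolding cherry_def using integral_abs_bound by (simp add: case_prod_beta')
  also have "\<dots> \<le> (\<integral>p. ((case p of (x, y, z) \<Rightarrow> (dev a (x, y))\<^sup>2) + (case p of (x, y, z) \<Rightarrow> (dev a (y, z))\<^sup>2)) / 2 \<partial>unit_meas3)"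
  proof (rule integral_mono)
    show "integrable unit_meas3 (\<lambda>(x, y, z). \<bar>dev a (x, y) * dev a (y, z)\<bar>)"
      using integrable_abs[OF integrable_dev_mult[of "\<lambda>(x, y, z). (x, y)" "\<lambda>(x, y, z). (y, z)" a a]]
      by (simp add: case_prod_beta')
    show "(case p of (x, y, z) \<Rightarrow> \<bar>dev a (x, y) * dev a (y, z)\<bar>)
      \<le> ((case p of (x, y, z) \<Rightarrow> (dev a (x, y))\<^sup>2) + (case p of (x, y, z) \<Rightarrow> (dev a (y, z))\<^sup>2)) / 2" for p
      using sum_squares_bound[of "\<bar>dev a (fst p, fst (snd p))\<bar>" "\<bar>dev a (fst (snd p), snd (snd p))\<bar>"]
      by (simp add: case_prod_beta' abs_mult)
  qed (use int in \<open>simp add: case_prod_beta'\<close>)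
  also have "\<dots> = (\<integral>p. (dev a p)\<^sup>2 \<partial>unit_meas2)"
    using int integral_unit_meas3_pairs(2)[of "\<lambda>p. (dev a p)\<^sup>2"] integral_unit_meas3_snd[of "\<lambda>p. (dev a p)\<^sup>2"]
    by (simp add: case_prod_beta')
  finally show ?thesis .
qed

text \<open>With the first edge fixed, the deviations of the three colours on the second edge cancel
  pointwise.\<close>

lemma sum_cherry: "cherry a 1 + cherry a 2 + cherry a 3 = 0"
proof -
  have int: "integrable unit_meas3 (\<lambda>(x, y, z). dev a (x, y) * dev b (y, z))" for b
    using integrable_dev_mult[of "\<lambda>(x, y, z). (x, y)" "\<lambda>(x, y, z). (y, z)" a b]
    by (simp add: case_prod_beta')
  have "cherry a 1 + cherry a 2 + cherry a 3
    = (\<integral>p. (case p of (x, y, z) \<Rightarrow> dev a (x, y) * dev 1 (y, z)) + (case p of (x, y, z) \<Rightarrow> dev a (x, y) * dev 2 (y, z))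
        + (case p of (x, y, z) \<Rightarrow> dev a (x, y) * dev 3 (y, z)) \<partial>unit_meas3)"
    unfolding cherry_def using int by simp
  also have "\<dots> = (\<integral>p. 0 \<partial>unit_meas3)"
  proof (rule Bochner_Integration.integral_cong)
    fix p
    have "dev 1 q + dev 2 q + dev 3 q = 0" for q
      by (rule sum_dev)
    then show "(case p of (x, y, z) \<Rightarrow> dev a (x, y) * dev 1 (y, z)) + (case p of (x, y, z) \<Rightarrow> dev a (x, y) * dev 2 (y, z))
        + (case p of (x, y, z) \<Rightarrow> dev a (x, y) * dev 3 (y, z)) = 0"
      by (simp add: case_prod_beta' flip: distrib_left)
  qed simp
  finally show ?thesis by simp
qed

lemma abs_sum_cherry_le: "\<bar>cherry 1 2 + cherry 2 3 + cherry 3 1\<bar> \<le> var / 2"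
proof -
  \<comment> \<open>The 3 by 3 matrix of cherries is symmetric with zero row sums, so its
    off-diagonal entries add up to minus its trace.\<close>
  have "2 * (cherry 1 2 + cherry 2 3 + cherry 3 1) = - (cherry 1 1 + cherry 2 2 + cherry 3 3)"
    using sum_cherry[of 1] sum_cherry[of 2] sum_cherry[of 3] cherry_commute[of 1 2] cherry_commute[of 2 3]
      cherry_commute[of 3 1] by argo
  then show ?thesis
    using abs_cherry_self_le[of 1] abs_cherry_self_le[of 2] abs_cherry_self_le[of 3]
    unfolding var_eq abs_le_iff by argo
qed

definition dev_triangle :: real where
  "dev_triangle = (\<integral>(x, y, z). dev 1 (x, y) * dev 2 (y, z) * dev 3 (z, x) \<partial>unit_meas3)"

lemma integrable_dev_triangle:
  "integrable unit_meas3 (\<lambda>(x, y, z). dev 1 (x, y) * dev 2 (y, z) * dev 3 (z, x))"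
proof (rule unit3.integrable_const_bound [of _ "2/3 * (2/3) * (2/3)"])
  show "AE p in unit_meas3. norm (case p of (x, y, z) \<Rightarrow> dev 1 (x, y) * dev 2 (y, z) * dev 3 (z, x)) \<le> 2/3 * (2/3) * (2/3)"
    unfolding real_norm_def abs_mult case_prod_beta'
    by (intro AE_I2 mult_mono abs_dev_le mult_nonneg_nonneg abs_ge_zero) auto
qed simp

lemma abs_dev_triangle_le: "\<bar>dev_triangle\<bar> \<le> 2/9 * var"
proof -
  have int: "integrable unit_meas3 (\<lambda>(x, y, z). (dev 1 (x, y))\<^sup>2)"
    "integrable unit_meas3 (\<lambda>(x, y, z). (dev 2 (y, z))\<^sup>2)" "integrable unit_meas3 (\<lambda>(x, y, z). (dev 3 (z, x))\<^sup>2)"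
    using integrable_dev_mult[of "\<lambda>(x, y, z). (x, y)" "\<lambda>(x, y, z). (x, y)" 1 1]
      integrable_dev_mult[of "\<lambda>(x, y, z). (y, z)" "\<lambda>(x, y, z). (y, z)" 2 2]
      integrable_dev_mult[of "\<lambda>(x, y, z). (z, x)" "\<lambda>(x, y, z). (z, x)" 3 3]
    by (simp_all add: case_prod_beta' power2_eq_square)
  have "\<bar>dev_triangle\<bar> \<le> (\<integral>p. \<bar>case p of (x, y, z) \<Rightarrow> dev 1 (x, y) * dev 2 (y, z) * dev 3 (z, x)\<bar> \<partial>unit_meas3)"
    unfolding dev_triangle_def by (rule integral_abs_bound)
  also have "\<dots> \<le> (\<integral>p. 2/9 * ((case p of (x, y, z) \<Rightarrow> (dev 1 (x, y))\<^sup>2) + (case p of (x, y, z) \<Rightarrow> (dev 2 (y, z))\<^sup>2)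
      + (case p of (x, y, z) \<Rightarrow> (dev 3 (z, x))\<^sup>2)) \<partial>unit_meas3)"
  proof (rule integral_mono)
    show "\<bar>case p of (x, y, z) \<Rightarrow> dev 1 (x, y) * dev 2 (y, z) * dev 3 (z, x)\<bar>
      \<le> 2/9 * ((case p of (x, y, z) \<Rightarrow> (dev 1 (x, y))\<^sup>2) + (case p of (x, y, z) \<Rightarrow> (dev 2 (y, z))\<^sup>2)
      + (case p of (x, y, z) \<Rightarrow> (dev 3 (z, x))\<^sup>2))" for p
      using abs_triple_prod_le[OF abs_dev_le abs_dev_le abs_dev_le]
      by (simp add: case_prod_beta')
  qed (use int integrable_dev_triangle in \<open>simp_all add: case_prod_beta'\<close>)
  also have "\<dots> = 2/9 * var"
    using int integral_unit_meas3_pairs(2)[of "\<lambda>p. (dev 1 p)\<^sup>2"] integral_unit_meas3_snd[of "\<lambda>p. (dev 2 p)\<^sup>2"]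
      integral_unit_meas3_pairs(1)[of "\<lambda>p. (dev 3 p)\<^sup>2"]
    by (simp add: var_eq case_prod_beta')
  finally show ?thesis .
qed

lemma triangle_density_eq:
  "(\<integral>(x, y, z). V (x, y) $ 1 * V (y, z) $ 2 * V (z, x) $ 3 \<partial>unit_meas3)
    = 1/27 + (cherry 1 2 + cherry 2 3 + cherry 3 1) / 3 + dev_triangle"
proof -
  let ?f1 = "\<lambda>p. case p of (x, y, z) \<Rightarrow> dev 1 (x, y)" and ?f2 = "\<lambda>p. case p of (x, y, z) \<Rightarrow> dev 2 (y, z)"
    and ?f3 = "\<lambda>p. case p of (x, y, z) \<Rightarrow> dev 3 (z, x)"
  let ?g1 = "\<lambda>p. case p of (x, y, z) \<Rightarrow> dev 1 (x, y) * dev 2 (y, z)"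
    and ?g2 = "\<lambda>p. case p of (x, y, z) \<Rightarrow> dev 2 (y, z) * dev 3 (z, x)"
    and ?g3 = "\<lambda>p. case p of (x, y, z) \<Rightarrow> dev 3 (z, x) * dev 1 (x, y)"
    and ?h = "\<lambda>p. case p of (x, y, z) \<Rightarrow> dev 1 (x, y) * dev 2 (y, z) * dev 3 (z, x)"
  have f: "integrable unit_meas3 ?f1" "integrable unit_meas3 ?f2" "integrable unit_meas3 ?f3"
    by (rule unit3.integrable_const_bound [of _ "2/3"], simp only: case_prod_beta' real_norm_def abs_dev_le AE_I2, measurable)+
  have g: "integrable unit_meas3 ?g1" "integrable unit_meas3 ?g2" "integrable unit_meas3 ?g3"
    using integrable_dev_mult[of "\<lambda>(x, y, z). (x, y)" "\<lambda>(x, y, z). (y, z)" 1 2]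
      integrable_dev_mult[of "\<lambda>(x, y, z). (y, z)" "\<lambda>(x, y, z). (z, x)" 2 3]
      integrable_dev_mult[of "\<lambda>(x, y, z). (z, x)" "\<lambda>(x, y, z). (x, y)" 3 1]
    by (simp_all add: case_prod_beta')
  \<comment> \<open>The three linear terms sit on different edges and do not cancel pointwise; once
    each is integrated down to the square, they do.\<close>
  have "(\<integral>p. dev 1 p \<partial>unit_meas2) + (\<integral>p. dev 2 p \<partial>unit_meas2) + (\<integral>p. dev 3 p \<partial>unit_meas2)
    = (\<integral>p. dev 1 p + dev 2 p + dev 3 p \<partial>unit_meas2)"
    by (simp add: integrable_dev)
  then have 0: "(\<integral>p. ?f1 p \<partial>unit_meas3) + (\<integral>p. ?f2 p \<partial>unit_meas3) + (\<integral>p. ?f3 p \<partial>unit_meas3) = 0"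
    using integral_unit_meas3_pairs(2)[of "dev 1"] integral_unit_meas3_snd[of "dev 2"] integral_unit_meas3_pairs(1)[of "dev 3"]
    by (simp add: sum_dev case_prod_beta')
  have "(\<integral>(x, y, z). V (x, y) $ 1 * V (y, z) $ 2 * V (z, x) $ 3 \<partial>unit_meas3)
    = (\<integral>p. 1/27 + 1/9 * (?f1 p + ?f2 p + ?f3 p) + 1/3 * (?g1 p + ?g2 p + ?g3 p) + ?h p \<partial>unit_meas3)"
    by (intro Bochner_Integration.integral_cong) (auto simp: dev_def field_simps)
  also have "\<dots> = 1/27 + 1/9 * ((\<integral>p. ?f1 p \<partial>unit_meas3) + (\<integral>p. ?f2 p \<partial>unit_meas3) + (\<integral>p. ?f3 p \<partial>unit_meas3))
    + 1/3 * ((\<integral>p. ?g1 p \<partial>unit_meas3) + (\<integral>p. ?g2 p \<partial>unit_meas3) + (\<integral>p. ?g3 p \<partial>unit_meas3)) + (\<integral>p. ?h p \<partial>unit_meas3)"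
    using f g integrable_dev_triangle by simp
  also have "\<dots> = 1/27 + (cherry 1 2 + cherry 2 3 + cherry 3 1) / 3 + dev_triangle"
    unfolding 0 cherry_rotations dev_triangle_def by (simp add: cherry_def)
  finally show ?thesis .
qed

lemma triangle_density_bound:
  "\<bar>(\<integral>(x, y, z). V (x, y) $ 1 * V (y, z) $ 2 * V (z, x) $ 3 \<partial>unit_meas3) - 1/27\<bar> \<le> 7/18 * var"
  using abs_sum_cherry_le abs_dev_triangle_le 
  unfolding triangle_density_eq abs_le_iff by argo

section \<open>Entropy of a Borel version\<close>

lemma integrable_mult_ln: "integrable unit_meas2 (\<lambda>p. V p $ a * ln (V p $ a))"
proof (rule unit2.integrable_const_bound [of _ 1])
  have "\<bar>w * ln w\<bar> \<le> 1" if "0 \<le> w" "w \<le> 1" for w :: real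
  proof (cases "w = 0")
    case False
    \<comment> \<open>From ln v <= v - 1 at v = 1/w; after multiplication by w this gives 0 <= - w
      ln w <= 1 - w, hence the bound 1.\<close>
    then have "- ln w \<le> 1 / w - 1"
      using ln_le_minus_one[of "1/w"] that by (simp add: ln_div)
    then have "w * (- ln w) \<le> w * (1 / w - 1)"
      using that by (intro mult_left_mono)
    moreover have "w * ln w \<le> 0"
      using that False by (simp add: mult_nonneg_nonpos)
    ultimately show ?thesis
      using that False by (simp add: algebra_simps)
  qed simp
  then show "AE p in unit_meas2. norm (V p $ a * ln (V p $ a)) \<le> 1"
    using simplex by (auto simp: simplex3_def)
qed simp

lemma entropy_bound:
  "(\<Sum>a\<in>UNIV. \<integral>p. V p $ a * ln (V p $ a) \<partial>unit_meas2) \<ge> - ln 3 + 7/9 * var"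
proof -
  have "- ln 3 + 7/9 * var = (\<integral>p. - ln 3 + 7/9 * (\<Sum>a\<in>UNIV. (dev a p)\<^sup>2) \<partial>unit_meas2)"
    unfolding var_def by (simp add: integrable_dev_sq)
  also have "\<dots> \<le> (\<integral>p. (\<Sum>a\<in>UNIV. V p $ a * ln (V p $ a)) \<partial>unit_meas2)"
    unfolding dev_def
    by (intro integral_mono simplex3_entropy_ge simplex Bochner_Integration.integrable_sum integrable_mult_ln)
      (use integrable_dev_sq in \<open>simp add: dev_def\<close>)
  finally show ?thesis by (simp add: integrable_mult_ln)
qed

lemma var_eq_0_imp:
  assumes "var = 0"
  shows "AE p in unit_meas2. V p = (\<chi> a. 1/3)"
proof -
  have "AE p in unit_meas2. (\<Sum>a\<in>UNIV. (dev a p)\<^sup>2) = 0"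
    using assms unfolding var_def
    by (subst (asm) integral_nonneg_eq_0_iff_AE)
      (auto intro!: Bochner_Integration.integrable_sum integrable_dev_sq sum_nonneg)
  then show ?thesis
    by eventually_elim (auto simp: sum_nonneg_eq_0_iff vec_eq_iff dev_def)
qed

end

section \<open>Numerical bounds\<close>

text \<open>
  The logarithms of 2, 3, 5 are integer combinations of those of 16/15, 25/24, 81/80, and the remaining
  arguments in \<open>B0\<close> are products of 2, 3, 5 and one quotient close to 1. The lower bound
  on \<open>B0\<close> has a margin of only about \<open>3 \<cdot> 10\<^sup>-\<^sup>1\<^sup>2\<close>, whence the 18 digits.
\<close>

lemma ln_16_15_bounds: "ln (16/15 :: real) \<in> {64538521137571171/1000000000000000000..64538521137571172/1000000000000000000}"
  using ln_approx_bounds[of "16/15" 6] by (simp add: eval_nat_numeral)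

lemma ln_25_24_bounds: "ln (25/24 :: real) \<in> {40821994520255129/1000000000000000000..40821994520255130/1000000000000000000}"
  using ln_approx_bounds[of "25/24" 6] by (simp add: eval_nat_numeral)

lemma ln_81_80_bounds: "ln (81/80 :: real) \<in> {12422519998557153/1000000000000000000..12422519998557154/1000000000000000000}"
  using ln_approx_bounds[of "81/80" 4] by (simp add: eval_nat_numeral)

lemma ln_500_499_bounds: "ln (500/499 :: real) \<in> {2002002670673077/1000000000000000000..2002002670673078/1000000000000000000}"
  using ln_approx_bounds[of "500/499" 3] by (simp add: eval_nat_numeral)

lemma ln_512_509_bounds: "ln (512/509 :: real) \<in> {5876608488985041/1000000000000000000..5876608488985042/1000000000000000000}"
  using ln_approx_bounds[of "512/509" 4] by (simp add: eval_nat_numeral)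

lemma ln_20_19_bounds: "ln (20/19 :: real) \<in> {51293294387550533/1000000000000000000..51293294387550534/1000000000000000000}"
  using ln_approx_bounds[of "20/19" 6] by (simp add: eval_nat_numeral)

lemma ln_1125_1109_bounds: "ln (1125/1109 :: real) \<in> {14324327288153471/1000000000000000000..14324327288153472/1000000000000000000}"
  using ln_approx_bounds[of "1125/1109" 4] by (simp add: eval_nat_numeral)

lemma B0_bounds: "14.0049634433 \<le> B0" "B0 < 14.0049634434" and Delta0_pos: "Delta0 > 0"
proof -
  define a b c where "a = ln (16/15::real)" and "b = ln (25/24::real)" and "c = ln (81/80::real)"
  have "a = ln (2^4) - ln (3*5)" "b = ln (5^2) - ln (2^3*3)" "c = ln (3^4) - ln (2^4*5)"
    unfolding a_def b_def c_def by (simp_all only: ln_divide_pos [symmetric] zero_less_numeral zero_less_power mult_pos_pos divide_pos_pos, simp_all?)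
  then have *: "a = 4 * ln 2 - ln 3 - ln 5" "b = 2 * ln 5 - 3 * ln 2 - ln 3" "c = 4 * ln 3 - 4 * ln 2 - ln 5"
    by (simp_all only: ln_realpow ln_mult_pos zero_less_numeral zero_less_power, simp_all?)
  \<comment> \<open>Inverse of the integer system \<open>*\<close>, whose determinant is a
    unit.\<close>
  have ln2: "ln (2::real) = 7 * a + 5 * b + 3 * c" and ln3: "ln (3::real) = 11 * a + 8 * b + 5 * c"
    and ln5: "ln (5::real) = 16 * a + 12 * b + 7 * c"
    unfolding * by simp_all
  \<comment> \<open>The numerators are 9 * 499, 509, 19 and 9 * 1109. Each of the primes 499, 509,
    19, 1109 is replaced by a nearby product of 2, 3, 5, namely 500, 512, 20, 1125, and a quotient
    close to 1.\<close>
  have "ln q0 = ln (3^2 * (2^2 * 5^3)) - ln (2^3 * 5^4) - ln (500/499)"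
    "ln ((1 - q0)/2) = ln (2^9) - ln (2^4 * 5^4) - ln (512/509)"
    "ln s0 = ln (2^2 * 5) - ln (2^4 * 5^4) - ln (20/19)"
    "ln ((1 - s0)/2) = ln (3^4 * 5^3) - ln (2^5 * 5^4) - ln (1125/1109)"
    unfolding q0_def s0_def by (simp_all only: ln_divide_pos [symmetric] zero_less_numeral zero_less_power mult_pos_pos divide_pos_pos, simp_all?)
  then have L:
    "ln q0 = 2 * ln 3 - ln 2 - ln 5 - ln (500/499)"
    "ln ((1 - q0)/2) = 5 * ln 2 - 4 * ln 5 - ln (512/509)"
    "ln s0 = - 2 * ln 2 - 3 * ln 5 - ln (20/19)"
    "ln ((1 - s0)/2) = 4 * ln 3 - 5 * ln 2 - ln 5 - ln (1125/1109)"
    by (simp_all only: ln_realpow ln_mult_pos zero_less_numeral zero_less_power mult_pos_pos, simp_all?)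
  note bnds = ln_16_15_bounds[folded a_def] ln_25_24_bounds[folded b_def] ln_81_80_bounds[folded c_def]
    ln_500_499_bounds ln_512_509_bounds ln_20_19_bounds ln_1125_1109_bounds
  define n where "n = ln 3 - 1/2 * (h_fun q0 + h_fun s0)"
  have n: "n = ln 3 + 4491/10000 * ln q0 + 509/10000 * ln ((1 - q0)/2)
    + 19/20000 * ln s0 + 9981/20000 * ln ((1 - s0)/2)"
    unfolding n_def h_fun_def by (simp add: q0_def s0_def field_simps)
  \<comment> \<open>With denominators cleared, n is an integer combination of the seven enclosed
    logarithms, so the bounds become linear arithmetic.\<close>
  have n': "20000 * n = 110451 * a + 76825 * b + 66291 * c - 8982 * ln (500/499)
    - 1018 * ln (512/509) - 19 * ln (20/19) - 9981 * ln (1125/1109)"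
    unfolding n L ln2 ln3 ln5 by (simp add: field_simps)
  note bnds' = bnds [unfolded atLeastAtMost_iff, THEN conjunct1] bnds [unfolded atLeastAtMost_iff, THEN conjunct2]
  have "140049634433/10000000000 * (4210540070599/108000000000000) \<le> n"
    using bnds' n' by linarith
  moreover have "n < 140049634434/10000000000 * (4210540070599/108000000000000)"
    using bnds' n' by linarith
  moreover have d: "2 * Delta0 = 4210540070599/108000000000000"
    by (simp add: Delta0_def tau_fun_def q0_def s0_def eval_nat_numeral)
  ultimately show "14.0049634433 \<le> B0" "B0 < 14.0049634434"
    unfolding B0_def n_def [symmetric] d by (simp_all add: field_simps)
  show "Delta0 > 0"
    using d by simp
qed

section \<open>The functional on constant and two-block graphons\<close>

text \<open>The triangle and entropy estimates combined, for arbitrary beta. If |beta| > 1 the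
  coefficient of v is positive, and v <= 4/3 = 3 * 4/9 is what still bounds the functional.\<close>

lemma rb_functional_le:
  assumes "W \<in> prob_graphons3"
  obtains v where "0 \<le> v" "v \<le> 4/3"
    "rb_functional \<beta> W \<le> \<beta> / 27 + ln 3 / 2 - 7/18 * (1 - \<bar>\<beta>\<bar>) * v"
    "v = 0 \<Longrightarrow> AE p in unit_meas2. W p = (\<chi> a. 1/3)"
proof -
  obtain V where V: "V \<in> borel_measurable borel" "\<And>p. V p \<in> simplex3" "\<And>x y. V (x, y) = V (y, x)"
    and ae: "AE p in unit_meas2. W p = V p"
    using prob_graphons3_borel_version [OF assms] by blast
  interpret symmetric_simplex_map V
    by unfold_locales (fact V)+
  define t where "t = t_rb W"
  have "\<bar>t - 1/27\<bar> \<le> 7/18 * var"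
    unfolding t_def t_rb_eq [OF V(1) ae] by (rule triangle_density_bound)
  then have "\<bar>\<beta> * (t - 1/27)\<bar> \<le> \<bar>\<beta>\<bar> * (7/18 * var)"
    unfolding abs_mult by (rule mult_left_mono) simp
  from order_trans [OF abs_ge_self this]
  have "\<beta> * t \<le> \<beta> / 27 + 7/18 * (\<bar>\<beta>\<bar> * var)"
    by (simp add: right_diff_distrib)
  moreover have "entropy3 W \<ge> - ln 3 + 7/9 * var"
    unfolding entropy3_eq [OF V(1) ae] by (rule entropy_bound)
  moreover have "7/18 * (1 - \<bar>\<beta>\<bar>) * var = 7/18 * var - 7/18 * (\<bar>\<beta>\<bar> * var)"
    by (simp add: algebra_simps diff_divide_distrib)
  ultimately have "rb_functional \<beta> W \<le> \<beta> / 27 + ln 3 / 2 - 7/18 * (1 - \<bar>\<beta>\<bar>) * var"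
    unfolding rb_functional_def t_def by linarith
  moreover have "AE p in unit_meas2. W p = (\<chi> a. 1/3)" if "var = 0"
    using ae var_eq_0_imp [OF that] by eventually_elim simp
  moreover have "var \<le> 4/3"
  proof -
    have "(\<integral>p. (dev a p)\<^sup>2 \<partial>unit_meas2) \<le> (\<integral>p. 4/9 \<partial>unit_meas2)" for a
      by (intro integral_mono integrable_dev_sq dev_sq_le) simp
    from this[of 1] this[of 2] this[of 3] show ?thesis
      unfolding var_eq by (simp add: power2_eq_square)
  qed
  ultimately show thesis
    using that var_nonneg by blast
qed

lemma const_prob_graphon: "p \<in> simplex3 \<Longrightarrow> (\<lambda>_. p) \<in> prob_graphons3"
  by (simp add: prob_graphons3_def)

lemma rb_functional_AE_const:
  assumes "AE q in unit_meas2. W q = p"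
  shows "rb_functional \<beta> W = \<beta> * (p $ 1 * p $ 2 * p $ 3) - 1/2 * (\<Sum>i\<in>UNIV. p $ i * ln (p $ i))"
  using t_rb_eq [of "\<lambda>_. p" W] entropy3_eq [of "\<lambda>_. p" W] assms
  by (simp add: rb_functional_def case_prod_beta')

lemma rb_functional_AE_third:
  assumes "AE q in unit_meas2. W q = (\<chi> a. 1/3)"
  shows "rb_functional \<beta> W = \<beta> / 27 + ln 3 / 2"
  unfolding rb_functional_AE_const [OF assms] by (simp add: ln_div)

lemma rb_functional_const:
  "rb_functional \<beta> (\<lambda>_. p) = \<beta> * (p $ 1 * p $ 2 * p $ 3) - 1/2 * (\<Sum>i\<in>UNIV. p $ i * ln (p $ i))"
  by (rule rb_functional_AE_const) simp

lemma psi_rb_const_eq: "psi_rb_const \<beta> = (SUP p\<in>simplex3. rb_functional \<beta> (\<lambda>_. p))"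
  by (simp add: psi_rb_const_def rb_functional_const)

text \<open>A real supremum lies above its members only when the set is bounded; this lets a single
  competitor bound \<open>psi_rb\<close> from below.\<close>

lemma bdd_above_rb_functional: "bdd_above (rb_functional \<beta> ` prob_graphons3)"
proof (rule bdd_aboveI2)
  fix W assume "W \<in> prob_graphons3"
  then obtain v where v: "0 \<le> v" "v \<le> 4/3"
    "rb_functional \<beta> W \<le> \<beta> / 27 + ln 3 / 2 - 7/18 * (1 - \<bar>\<beta>\<bar>) * v"
    by (rule rb_functional_le)
  have "- (1 - \<bar>\<beta>\<bar>) * v \<le> \<bar>\<beta>\<bar> * (4/3)"
    using mult_left_mono [OF v(2), of "\<bar>\<beta>\<bar>"] v(1) by (simp add: algebra_simps)
  with v(3) show "rb_functional \<beta> W \<le> \<beta> / 27 + ln 3 / 2 + 7/18 * (\<bar>\<beta>\<bar> * (4/3))"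
    by linarith
qed

lemma psi_rb_const_le:
  assumes "\<beta> \<ge> 0"
  shows "psi_rb_const \<beta> \<le> \<beta> / 27 + ln 3 / 2"
  unfolding psi_rb_const_def
proof (rule cSUP_least)
  fix p assume p: "p \<in> simplex3"
  have "\<beta> * (p $ 1 * p $ 2 * p $ 3) \<le> \<beta> * (1/27)"
    using simplex3_prod_le [OF p] assms by (rule mult_left_mono)
  moreover have "- ln 3 \<le> (\<Sum>a\<in>UNIV. p $ a * ln (p $ a))"
    using simplex3_entropy_ge [OF p] sum_nonneg [of UNIV "\<lambda>a. (p $ a - 1/3)\<^sup>2"] by simp
  ultimately show "\<beta> * (p $ 1 * p $ 2 * p $ 3) - 1/2 * (\<Sum>i\<in>UNIV. p $ i * ln (p $ i)) \<le> \<beta> / 27 + ln 3 / 2"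
    by linarith
qed (use simplex3_third in auto)

section \<open>The two-block competitor\<close>

definition one_distinguished :: "real \<Rightarrow> real^3" where
  "one_distinguished u = (\<chi> a. if a = 1 then u else (1 - u) / 2)"

text \<open>A rainbow triangle arises mostly from two vertices in one block, joined by colour 1, and
  a third in the other block reached by colours 2 and 3. Hence \<open>q0\<close> is large and
  \<open>s0\<close> tiny.\<close>

definition block_graphon :: "real \<times> real \<Rightarrow> real^3" where
  "block_graphon = (\<lambda>(x, y). one_distinguished (if (x \<le> 1/2) = (y \<le> 1/2) then q0 else s0))"

lemma one_distinguished_nth [simp]:
  "one_distinguished u $ 1 = u" "one_distinguished u $ 2 = (1 - u) / 2" "one_distinguished u $ 3 = (1 - u) / 2"
  by (simp_all add: one_distinguished_def)

lemma one_distinguished_simplex3: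
  assumes "0 \<le> u" "u \<le> 1"
  shows "one_distinguished u \<in> simplex3"
  using assms by (simp add: simplex3_def forall_3)

lemma block_graphon_simplex3: "block_graphon p \<in> simplex3"
  by (auto simp: block_graphon_def q0_def s0_def intro!: one_distinguished_simplex3 split: prod.split)

lemma block_graphon_measurable: "block_graphon \<in> borel_measurable borel"
proof -
  have "block_graphon p $ a = (if (fst p \<le> 1/2) = (snd p \<le> 1/2)
      then one_distinguished q0 $ a else one_distinguished s0 $ a)" for p a
    by (simp add: block_graphon_def case_prod_beta')
  then show ?thesis
    unfolding borel_measurable_vec_iff borel_prod [symmetric] by simp
qed

lemma block_graphon_in: "block_graphon \<in> prob_graphons3"
proof -
  have "block_graphon \<in> borel_measurable (lebesgue_on unit_square)"
    by (intro measurable_restrict_space1 measurable_completion) (use block_graphon_measurable in simp)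
  then show ?thesis
    by (auto simp: prob_graphons3_def block_graphon_simplex3) (auto simp: block_graphon_def)
qed

lemma integral_unit_meas_half:
  fixes g :: "bool \<Rightarrow> real"
  shows "(\<integral>x. g (x \<le> 1/2) \<partial>unit_meas) = (g True + g False) / 2"
proof -
  have "emeasure unit_meas {..1/2} = emeasure lborel ({0..1} \<inter> {..1/2 :: real})"
    by (rule emeasure_unit_meas) simp
  also have "{0..1} \<inter> {..1/2 :: real} = {0..1/2}" by auto
  finally have m: "measure unit_meas {..1/2} = 1/2"
    by (intro measure_eq_emeasure_eq_ennreal) simp_all
  have "(\<integral>x. g (x \<le> 1/2) \<partial>unit_meas) = (\<integral>x. g False + (g True - g False) * indicator {..1/2} x \<partial>unit_meas)"
    by (intro Bochner_Integration.integral_cong) (auto split: split_indicator)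
  also have "\<dots> = g False + (g True - g False) * (1/2)"
  proof -
    have "integrable unit_meas (indicator {..1/2} :: real \<Rightarrow> real)"
      by (rule integrable_real_indicator) (simp_all add: sets_unit_meas unit.emeasure_eq_measure)
    then show ?thesis
      using m by (simp add: measure_def)
  qed
  finally show ?thesis by (simp add: field_simps)
qed

lemma block_graphon_t_rb: "t_rb block_graphon = tau_fun q0 s0"
proof -
  define w where "w a b c = one_distinguished (if a = b then q0 else s0) $ c" for a b :: bool and c :: 3
  have bw: "block_graphon (x, y) $ c = w (x \<le> 1/2) (y \<le> 1/2) c" for x y c
    by (simp add: block_graphon_def w_def)
  define F where "F = (\<lambda>(x, y, z). block_graphon (x, y) $ 1 * block_graphon (y, z) $ 2 * block_graphon (z, x) $ 3)"
  have "block_graphon \<in> borel_measurable (borel \<Otimes>\<^sub>M borel)"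
    using block_graphon_measurable by (simp add: borel_prod)
  then have [measurable]: "\<And>c. (\<lambda>p. block_graphon p $ c) \<in> borel_measurable (borel \<Otimes>\<^sub>M borel)"
    by (simp add: borel_measurable_vec_iff)
  have F_meas [measurable]: "F \<in> borel_measurable unit_meas3"
    unfolding F_def by measurable
  have b: "\<bar>block_graphon p $ a\<bar> \<le> 1" for p a
    using block_graphon_simplex3 [of p] by (auto simp: simplex3_def)
  have Fb: "\<bar>F p\<bar> \<le> 1 * 1 * 1" for p
    unfolding F_def case_prod_beta' abs_mult by (intro mult_mono b) auto
  have int: "integrable unit_meas3 F"
    by (rule unit3.integrable_const_bound [of _ "1 * 1 * 1"]) (simp_all only: real_norm_def Fb AE_I2 F_meas)
  have int2: "integrable unit_meas2 (\<lambda>p. F (x, p))" for x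
    by (rule unit2.integrable_const_bound [of _ "1 * 1 * 1"], simp only: real_norm_def Fb AE_I2, measurable)
  have "t_rb block_graphon = (\<integral>p. F p \<partial>unit_meas3)"
    unfolding F_def by (rule t_rb_eq [OF block_graphon_measurable]) simp
  also have "\<dots> = (\<integral>x. \<integral>p. F (x, p) \<partial>unit_meas2 \<partial>unit_meas)"
    by (rule unit3.integral_fst' [OF int, symmetric])
  also have "\<dots> = (\<integral>x. \<integral>y. \<integral>z. F (x, y, z) \<partial>unit_meas \<partial>unit_meas \<partial>unit_meas)"
    by (intro Bochner_Integration.integral_cong refl unit2.integral_fst' [OF int2, symmetric])
  \<comment> \<open>The unreduced abstractions keep each integrand in the form g (x \<le> 1/2),
    which \<open>integral_unit_meas_half\<close> matches. The outcome is the average over the eight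
    block assignments.\<close>
  also have "\<dots> = (\<integral>x. \<integral>y. (\<lambda>a b. (\<Sum>c\<in>{True, False}. w a b 1 * w b c 2 * w c a 3) / 2) (x \<le> 1/2) (y \<le> 1/2) \<partial>unit_meas \<partial>unit_meas)"
    unfolding F_def prod.case bw
    by (subst integral_unit_meas_half [of "\<lambda>c. w _ _ _ * w _ c _ * w c _ _"]) simp
  also have "\<dots> = (\<integral>x. (\<lambda>a. (\<Sum>b\<in>{True, False}. (\<Sum>c\<in>{True, False}. w a b 1 * w b c 2 * w c a 3) / 2) / 2) (x \<le> 1/2) \<partial>unit_meas)"
    by (subst integral_unit_meas_half) simp
  also have "\<dots> = (\<Sum>a\<in>{True, False}. (\<Sum>b\<in>{True, False}. (\<Sum>c\<in>{True, False}. w a b 1 * w b c 2 * w c a 3) / 2) / 2) / 2"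
    by (subst integral_unit_meas_half) simp
  also have "\<dots> = tau_fun q0 s0"
    by (simp add: w_def tau_fun_def field_simps power2_eq_square power3_eq_cube)
  finally show ?thesis .
qed

lemma block_graphon_entropy3: "entropy3 block_graphon = - (h_fun q0 + h_fun s0) / 2"
proof -
  have half: "(\<integral>p. g ((fst p \<le> 1/2) = (snd p \<le> 1/2)) \<partial>unit_meas2) = (g True + g False) / 2"
    for g :: "bool \<Rightarrow> real"
  proof -
    \<comment> \<open>Whichever block contains x, the point y falls into the same block with
      probability 1/2.\<close>
    have inner: "(\<integral>y. g ((x \<le> 1/2) = (y \<le> 1/2)) \<partial>unit_meas) = (g True + g False) / 2" for x :: real
      using integral_unit_meas_half [of "\<lambda>b. g ((x \<le> 1/2) = b)"] by (cases "x \<le> 1/2") simp_all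
    \<comment> \<open>Measurability and boundedness are automatic for the explicit case distinction,
      which is then recognised as g of the block comparison.\<close>
    have "integrable unit_meas2 (\<lambda>p. if (fst p \<le> 1/2) = (snd p \<le> 1/2) then g True else g False)"
      by (rule unit2.integrable_const_bound [of _ "max \<bar>g True\<bar> \<bar>g False\<bar>"]) simp_all
    also have "(\<lambda>p. if (fst p \<le> 1/2) = (snd p \<le> 1/2) then g True else g False)
      = (\<lambda>p :: real \<times> real. g ((fst p \<le> 1/2) = (snd p \<le> 1/2)))"
      by (simp add: fun_eq_iff)
    finally have "(\<integral>p. g ((fst p \<le> 1/2) = (snd p \<le> 1/2)) \<partial>unit_meas2)
      = (\<integral>x. \<integral>y. g ((x \<le> 1/2) = (y \<le> 1/2)) \<partial>unit_meas \<partial>unit_meas)"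
      by (subst unit2.integral_fst' [symmetric]) simp_all
    then show ?thesis unfolding inner by (simp add: measure_def)
  qed
  have eq: "(\<integral>p. block_graphon p $ a * ln (block_graphon p $ a) \<partial>unit_meas2)
      = (one_distinguished q0 $ a * ln (one_distinguished q0 $ a)
        + one_distinguished s0 $ a * ln (one_distinguished s0 $ a)) / 2" for a
    using half [of "\<lambda>b. one_distinguished (if b then q0 else s0) $ a * ln (one_distinguished (if b then q0 else s0) $ a)"]
    by (simp add: block_graphon_def case_prod_beta')
  have "entropy3 block_graphon = (\<Sum>a\<in>UNIV. (one_distinguished q0 $ a * ln (one_distinguished q0 $ a)
      + one_distinguished s0 $ a * ln (one_distinguished s0 $ a)) / 2)"
    unfolding eq [symmetric] by (rule entropy3_eq [OF block_graphon_measurable]) simp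
  also have "\<dots> = - (h_fun q0 + h_fun s0) / 2"
    by (simp add: sum_3 h_fun_def field_simps)
  finally show ?thesis .
qed

text \<open>\<open>B0\<close> is the break-even point: the energy gain beta * \<open>Delta0\<close>
  has to exceed half of the entropy deficit ln 3 - (h(q0) + h(s0))/2.\<close>

lemma rb_functional_block_graphon_gt:
  assumes "\<beta> > B0"
  shows "rb_functional \<beta> block_graphon > \<beta> / 27 + ln 3 / 2"
proof -
  have "ln 3 - 1/2 * (h_fun q0 + h_fun s0) < \<beta> * (2 * Delta0)"
    using assms Delta0_pos unfolding B0_def by (simp add: pos_divide_less_eq)
  also have "\<beta> * (2 * Delta0) = 2 * (\<beta> * tau_fun q0 s0) - 2 * \<beta> / 27"
    by (simp add: Delta0_def algebra_simps)
  finally show ?thesis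
    unfolding rb_functional_def block_graphon_t_rb block_graphon_entropy3 by linarith
qed

section \<open>The cut distance to the uniform graphon\<close>

text \<open>In a completion f and g are measurable together or not at all; in the second case both
  integrals have the default value 0.\<close>

lemma integral_completion_cong_AE:
  fixes f g :: "'a \<Rightarrow> real"
  assumes ae: "AE x in M. f x = g x"
  shows "(\<integral>x. f x \<partial>completion M) = (\<integral>x. g x \<partial>completion M)"
proof (cases "f \<in> borel_measurable (completion M)")
  case True
  then have "g \<in> borel_measurable (completion M)"
    by (rule measurable_completion_AE) (use ae in \<open>auto elim: eventually_mono\<close>)
  with True show ?thesis
    by (intro integral_cong_AE AE_completion ae)
next
  case False
  then have "g \<notin> borel_measurable (completion M)"
    using measurable_completion_AE [OF _ ae] by auto
  with False show ?thesis
    using borel_measurable_integrable not_integrable_integral_eq by metis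
qed

lemma sets_lebesgue_on_subset: "A \<in> sets (lebesgue_on B) \<Longrightarrow> A \<subseteq> B"
  using sets.sets_into_space [of A "lebesgue_on B"] by (simp add: space_restrict_space)

lemma cut_norm_cong_AE:
  assumes ae: "AE p in unit_meas2. U p = U' p"
  shows "cut_norm U = cut_norm U'"
  unfolding cut_norm_def
proof (rule SUP_cong [OF refl])
  fix ST :: "real set \<times> real set"
  assume "ST \<in> sets (lebesgue_on {0..1}) \<times> sets (lebesgue_on {0..1})"
  then obtain S T where ST: "ST = (S, T)" "S \<subseteq> {0..1}" "T \<subseteq> {0..1}"
    by (cases ST) (auto dest: sets_lebesgue_on_subset)
  have "AE p in lborel. indicator (S \<times> T) p *\<^sub>R U p = indicator (S \<times> T) p *\<^sub>R U' p"
    using ae unfolding AE_unit_meas2_iff by eventually_elim (use ST in \<open>auto split: split_indicator\<close>)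
  then show "(case ST of (S, T) \<Rightarrow> \<bar>set_lebesgue_integral lebesgue (S \<times> T) U\<bar>)
      = (case ST of (S, T) \<Rightarrow> \<bar>set_lebesgue_integral lebesgue (S \<times> T) U'\<bar>)"
    unfolding ST set_lebesgue_integral_def by (simp only: prod.case integral_completion_cong_AE)
qed

text \<open>Holds for arbitrary U and A, because a non-integrable integrand has integral 0 and B is
  nonnegative.\<close>

lemma abs_set_integral_le:
  fixes U :: "real \<times> real \<Rightarrow> real"
  assumes U: "\<And>p. p \<in> unit_square \<Longrightarrow> \<bar>U p\<bar> \<le> B" and A: "A \<subseteq> unit_square"
  shows "\<bar>set_lebesgue_integral lebesgue A U\<bar> \<le> B"
proof -
  have 1: "(\<integral>p. indicator unit_square p *\<^sub>R 1 \<partial>lebesgue) = (1::real)"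
    using set_integral_lebesgue_eq [of unit_square "\<lambda>_. 1" "\<lambda>_. 1"]
    unfolding set_lebesgue_integral_def unit_meas2_eq [symmetric] by (simp add: borel_Times)
  \<comment> \<open>A nonzero integral certifies integrability, since the default value is
    0.\<close>
  then have int: "integrable lebesgue (\<lambda>p. indicator unit_square p *\<^sub>R (1::real))"
    using not_integrable_integral_eq by fastforce
  have "(0, 0) \<in> unit_square" by simp
  from order_trans [OF abs_ge_zero U [OF this]] have B: "0 \<le> B" .
  show ?thesis
  proof (cases "integrable lebesgue (\<lambda>p. indicator A p *\<^sub>R U p)")
    case True
    have "\<bar>set_lebesgue_integral lebesgue A U\<bar> \<le> (\<integral>p. \<bar>indicator A p *\<^sub>R U p\<bar> \<partial>lebesgue)"
      unfolding set_lebesgue_integral_def by (rule integral_abs_bound)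
    also have "\<dots> \<le> (\<integral>p. B * (indicator unit_square p *\<^sub>R 1) \<partial>lebesgue)"
    proof (rule integral_mono)
      show "integrable lebesgue (\<lambda>p. \<bar>indicator A p *\<^sub>R U p\<bar>)"
        using True by (rule integrable_abs)
      show "integrable lebesgue (\<lambda>p. B * (indicator unit_square p *\<^sub>R 1))"
        using int by (rule integrable_mult_right)
      show "\<bar>indicator A p *\<^sub>R U p\<bar> \<le> B * (indicator unit_square p *\<^sub>R 1)" for p
        using U [of p] A B by (auto split: split_indicator)
    qed
    also have "\<dots> = B"
      by (simp only: integral_mult_right_zero 1 mult_1_right)
    finally show ?thesis .
  next
    case False
    then show ?thesis
      using B by (simp add: set_lebesgue_integral_def not_integrable_integral_eq)
  qed
qed

lemma cut_norm_bounded: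
  fixes U :: "real \<times> real \<Rightarrow> real"
  assumes "\<And>p. p \<in> unit_square \<Longrightarrow> \<bar>U p\<bar> \<le> B"
  shows "bdd_above ((\<lambda>(S, T). \<bar>set_lebesgue_integral lebesgue (S \<times> T) U\<bar>) `
    (sets (lebesgue_on {0..1}) \<times> sets (lebesgue_on {0..1})))"
proof (rule bdd_aboveI2)
  fix ST :: "real set \<times> real set"
  assume "ST \<in> sets (lebesgue_on {0..1}) \<times> sets (lebesgue_on {0..1})"
  then obtain S T where ST: "ST = (S, T)" "S \<subseteq> {0..1}" "T \<subseteq> {0..1}"
    by (cases ST) (auto dest: sets_lebesgue_on_subset)
  show "(case ST of (S, T) \<Rightarrow> \<bar>set_lebesgue_integral lebesgue (S \<times> T) U\<bar>) \<le> B"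
    unfolding ST prod.case by (rule abs_set_integral_le [OF assms]) (use ST in auto)
qed

lemma cut_norm_ge:
  assumes "\<And>p. p \<in> unit_square \<Longrightarrow> \<bar>U p\<bar> \<le> B"
    and "S \<in> sets (lebesgue_on {0..1})" "T \<in> sets (lebesgue_on {0..1})"
  shows "\<bar>set_lebesgue_integral lebesgue (S \<times> T) U\<bar> \<le> cut_norm U"
  unfolding cut_norm_def
  using cSUP_upper [OF _ cut_norm_bounded [OF assms(1)], of "(S, T)"] assms(2,3) by simp

lemma cut_norm_nonneg:
  assumes "\<And>p. p \<in> unit_square \<Longrightarrow> \<bar>U p\<bar> \<le> B"
  shows "0 \<le> cut_norm U"
  using cut_norm_ge [of U B "{}" "{}", OF assms] by simp

lemma graphon_difference_bound:
  assumes U: "U \<in> prob_graphons3" and W: "W \<in> prob_graphons3" and \<phi>: "\<phi> \<in> mp_bijections"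
    and p: "p \<in> unit_square"
  shows "\<bar>(U p - relabel W \<phi> p) $ a\<bar> \<le> 1"
proof -
  obtain x y where p_eq: "p = (x, y)" and xy: "x \<in> {0..1}" "y \<in> {0..1}"
    using p by auto
  have "\<phi> x \<in> {0..1}" "\<phi> y \<in> {0..1}"
    using \<phi> xy by (auto simp: mp_bijections_def bij_betw_def)
  then have "W (\<phi> x, \<phi> y) \<in> simplex3" "U (x, y) \<in> simplex3"
    using U W xy by (auto simp: prob_graphons3_def)
  then have "0 \<le> W (\<phi> x, \<phi> y) $ a" "W (\<phi> x, \<phi> y) $ a \<le> 1" "0 \<le> U (x, y) $ a" "U (x, y) $ a \<le> 1"
    by (auto simp: simplex3_def)
  then show ?thesis by (simp add: p_eq relabel_def)
qed

lemma cut_norm3_nonneg: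
  assumes "U \<in> prob_graphons3" "W \<in> prob_graphons3" "\<phi> \<in> mp_bijections"
  shows "0 \<le> cut_norm3 (\<lambda>p. U p - relabel W \<phi> p)"
  unfolding cut_norm3_def
  by (intro sum_nonneg cut_norm_nonneg [of _ 1] graphon_difference_bound [OF assms])

lemma cut_norm_le_cut_norm3:
  assumes "U \<in> prob_graphons3" "W \<in> prob_graphons3" "\<phi> \<in> mp_bijections"
  shows "cut_norm (\<lambda>p. (U p - relabel W \<phi> p) $ a) \<le> cut_norm3 (\<lambda>p. U p - relabel W \<phi> p)"
  unfolding cut_norm3_def
  by (intro member_le_sum cut_norm_nonneg [of _ 1] graphon_difference_bound [OF assms]) auto

lemma id_mp_bijection: "(\<lambda>x. x) \<in> mp_bijections"
  by (simp add: mp_bijections_def bij_betw_def)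

lemma cut_dist3_refl:
  assumes "W \<in> prob_graphons3"
  shows "cut_dist3 W W = 0"
proof (rule antisym)
  have "sets (lebesgue_on {0..1::real}) \<noteq> {}"
    using sets.empty_sets by blast
  then have "cut_norm3 (\<lambda>p. W p - relabel W (\<lambda>x. x) p) = 0"
    by (simp add: relabel_def cut_norm3_def cut_norm_def case_prod_beta' set_lebesgue_integral_def)
  moreover have "cut_dist3 W W \<le> cut_norm3 (\<lambda>p. W p - relabel W (\<lambda>x. x) p)"
    unfolding cut_dist3_def
    by (rule cINF_lower [OF bdd_belowI2 id_mp_bijection]) (rule cut_norm3_nonneg [OF assms assms])
  ultimately show "cut_dist3 W W \<le> 0" by simp
  show "0 \<le> cut_dist3 W W"
    unfolding cut_dist3_def
    by (rule cINF_greatest) (use id_mp_bijection cut_norm3_nonneg [OF assms assms] in auto)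
qed

text \<open>By reflexivity every graphon belongs to its own class, so classes together with their
  representatives range over all graphons.\<close>

lemma psi_rb_eq: "psi_rb \<beta> = (SUP W\<in>prob_graphons3. rb_functional \<beta> W)"
proof -
  have "{rb_functional \<beta> W | C W. C \<in> graphon_classes3 \<and> W \<in> C} = rb_functional \<beta> ` prob_graphons3"
  proof safe
    fix C W assume "C \<in> graphon_classes3" "W \<in> C"
    then show "rb_functional \<beta> W \<in> rb_functional \<beta> ` prob_graphons3"
      by (auto simp: graphon_classes3_def quotient_def cut_equiv3_def)
  next
    fix W assume W: "W \<in> prob_graphons3"
    then have "cut_equiv3 `` {W} \<in> graphon_classes3"
      unfolding graphon_classes3_def by (rule quotientI)
    moreover have "W \<in> cut_equiv3 `` {W}"
      using W by (simp add: cut_equiv3_def cut_dist3_refl)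
    ultimately show "\<exists>C W'. rb_functional \<beta> W = rb_functional \<beta> W' \<and> C \<in> graphon_classes3 \<and> W' \<in> C"
      by blast
  qed
  then show ?thesis by (simp add: psi_rb_def)
qed

section \<open>Measure-preserving bijections and rectangle integrals\<close>

lemma AE_unit_meas_iff: "(AE x in unit_meas. P x) \<longleftrightarrow> (AE x in lborel. x \<in> {0..1} \<longrightarrow> P x)"
  unfolding unit_meas_def by (subst AE_density) (auto simp: indicator_def intro!: AE_cong)

lemma mp_bijection_measurable:
  assumes "\<phi> \<in> mp_bijections"
  shows "\<phi> \<in> borel_measurable (lebesgue_on {0..1})"
proof -
  have "\<phi> \<in> lebesgue_on {0..1} \<rightarrow>\<^sub>M lebesgue_on {0..1}"
    using assms by (simp add: mp_bijections_def)
  from measurable_compose [OF this id_borel_measurable_lebesgue_on] show ?thesis by simp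
qed

lemma mp_bijection_borel_version:
  assumes "\<phi> \<in> mp_bijections"
  obtains \<psi> where "\<psi> \<in> borel_measurable borel" "AE x in unit_meas. \<phi> x = \<psi> x"
proof -
  have "(\<lambda>x. if x \<in> {0..1} then \<phi> x else 0) \<in> borel_measurable lebesgue"
    using mp_bijection_measurable [OF assms] by (subst borel_measurable_if) auto
  from completion_ex_borel_measurable_real [OF this] obtain \<psi> where \<psi>: "\<psi> \<in> borel_measurable lborel"
    "AE x in lborel. (if x \<in> {0..1} then \<phi> x else 0) = \<psi> x"
    by blast
  have "AE x in unit_meas. \<phi> x = \<psi> x"
    unfolding AE_unit_meas_iff using \<psi>(2) by eventually_elim auto
  with \<psi>(1) that show thesis by simp
qed

text \<open>A Borel version \<open>\<psi>\<close> may lose bijectivity and leave the interval on a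
  null set, but its distribution is still that of \<open>\<phi>\<close>, which is all a change of
  variables asks for.\<close>

lemma distr_unit_meas:
  assumes \<phi>: "\<phi> \<in> mp_bijections" and \<psi> [measurable]: "\<psi> \<in> borel_measurable borel"
    and ae: "AE x in unit_meas. \<phi> x = \<psi> x"
  shows "distr unit_meas unit_meas \<psi> = unit_meas"
proof (rule measure_eqI)
  fix B assume "B \<in> sets (distr unit_meas unit_meas \<psi>)"
  then have B [measurable]: "B \<in> sets borel" by (simp add: sets_unit_meas)
  let ?L = "lebesgue_on {0..1::real}"
  have B01: "{0..1} \<inter> B \<in> sets borel" by simp
  then have BL: "{0..1} \<inter> B \<in> sets ?L"
    by (auto simp: sets_restrict_space)
  have \<phi>_L: "\<phi> \<in> ?L \<rightarrow>\<^sub>M ?L" and \<phi>_distr: "distr ?L ?L \<phi> = ?L" and \<phi>_im: "\<phi> ` {0..1} = {0..1}"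
    using \<phi> by (auto simp: mp_bijections_def bij_betw_def)
  have pre: "\<phi> -` ({0..1} \<inter> B) \<inter> {0..1} \<in> sets ?L"
    using measurable_sets [OF \<phi>_L BL] by simp
  have \<psi>B: "\<psi> -` B \<in> sets borel"
    using measurable_sets [OF \<psi> B] by simp
  have "emeasure (distr unit_meas unit_meas \<psi>) B = emeasure unit_meas (\<psi> -` B)"
    using B \<psi> by (subst emeasure_distr) (simp_all add: sets_unit_meas)
  also have "\<dots> = emeasure lebesgue ({0..1} \<inter> \<psi> -` B)"
    using \<psi>B by (simp add: emeasure_unit_meas)
  also have "\<dots> = emeasure lebesgue (\<phi> -` ({0..1} \<inter> B) \<inter> {0..1})"
  proof (rule emeasure_eq_AE)
    have "AE x in lebesgue. x \<in> {0..1} \<longrightarrow> \<phi> x = \<psi> x"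
      using ae unfolding AE_unit_meas_iff by (rule AE_completion)
    then show "AE x in lebesgue. (x \<in> {0..1} \<inter> \<psi> -` B) = (x \<in> \<phi> -` ({0..1} \<inter> B) \<inter> {0..1})"
    proof eventually_elim
      case (elim x)
      moreover have "\<phi> x \<in> {0..1}" if "x \<in> {0..1}"
        using that \<phi>_im by blast
      ultimately show ?case by auto
    qed
    show "{0..1} \<inter> \<psi> -` B \<in> sets lebesgue" using \<psi>B by simp
    show "\<phi> -` ({0..1} \<inter> B) \<inter> {0..1} \<in> sets lebesgue"
      using pre by (subst (asm) sets_restrict_space_iff) auto
  qed
  also have "\<dots> = emeasure (distr ?L ?L \<phi>) ({0..1} \<inter> B)"
    using BL \<phi>_L by (subst emeasure_distr) (simp_all add: emeasure_restrict_space)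
  also have "\<dots> = emeasure unit_meas B"
    unfolding \<phi>_distr using B01 by (simp add: emeasure_restrict_space emeasure_unit_meas)
  finally show "emeasure (distr unit_meas unit_meas \<psi>) B = emeasure unit_meas B" .
qed simp

lemma AE_unit_meas2_prod:
  assumes "AE x in unit_meas. P x"
  shows "AE p in unit_meas2. P (fst p) \<and> P (snd p)"
proof -
  obtain N where N: "{x. \<not> P x} \<subseteq> N" "N \<in> null_sets unit_meas"
    using assms by (auto elim!: AE_E simp: null_sets_def)
  then have [measurable]: "N \<in> sets borel"
    by (auto simp: null_sets_def sets_unit_meas)
  have N_ae: "AE x in unit_meas. x \<notin> N" using N(2) by (rule AE_not_in)
  have "AE p in unit_meas2. fst p \<notin> N \<and> snd p \<notin> N"
  proof (rule unit2.AE_pair_measure)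
    show "AE x in unit_meas. AE y in unit_meas. fst (x, y) \<notin> N \<and> snd (x, y) \<notin> N"
      using N_ae by eventually_elim (use N_ae in \<open>auto elim: eventually_mono\<close>)
  qed measurable
  then show ?thesis
    by eventually_elim (use N in auto)
qed

text \<open>Relabelling fixes the constant graphon, so pulling S and T back along
  \<open>\<phi>\<close> turns a rectangle integral of 1/3 - V into one of the relabelled difference.
  The left side is independent of \<open>\<phi>\<close> and therefore survives the infimum over
  relabellings.\<close>

lemma cut_norm_relabel_ge:
  assumes W: "W \<in> prob_graphons3" and \<phi>: "\<phi> \<in> mp_bijections"
    and V: "V \<in> borel_measurable borel" and ae: "AE p in unit_meas2. W p = V p"
    and S [measurable]: "S \<in> sets borel" and T [measurable]: "T \<in> sets borel"
  shows "\<bar>\<integral>p. indicator (S \<times> T) p * (1/3 - V p $ a) \<partial>unit_meas2\<bar>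
    \<le> cut_norm (\<lambda>p. ((\<chi> a. 1/3) - relabel W \<phi> p) $ a)"
proof -
  obtain \<psi> where \<psi> [measurable]: "\<psi> \<in> borel_measurable borel" and \<phi>\<psi>: "AE x in unit_meas. \<phi> x = \<psi> x"
    using mp_bijection_borel_version [OF \<phi>] by blast
  have \<phi>_im: "\<phi> ` {0..1} = {0..1}"
    using \<phi> by (auto simp: mp_bijections_def bij_betw_def)
  have [measurable]: "\<And>a. (\<lambda>p. V p $ a) \<in> borel_measurable (borel \<Otimes>\<^sub>M borel)"
    using V by (simp add: borel_prod borel_measurable_vec_iff)
  define \<Psi> where "\<Psi> = (\<lambda>(x, y). (\<psi> x, \<psi> y))"
  have \<Psi> [measurable]: "\<Psi> \<in> unit_meas2 \<rightarrow>\<^sub>M unit_meas2"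
    unfolding \<Psi>_def by measurable
  note distr_\<psi> = distr_unit_meas [OF \<phi> \<psi> \<phi>\<psi>]
  have distr_\<Psi>: "distr unit_meas2 unit_meas2 \<Psi> = unit_meas2"
    using pair_measure_distr [of \<psi> unit_meas unit_meas \<psi> unit_meas unit_meas]
      unit.sigma_finite_measure_axioms
    by (simp add: distr_\<psi> \<Psi>_def)
  define g where "g p = indicator (S \<times> T) p * (1/3 - V p $ a)" for p
  have g [measurable]: "g \<in> borel_measurable unit_meas2"
    unfolding g_def [abs_def] by measurable
  \<comment> \<open>Preimages under \<open>\<phi>\<close> itself are only Lebesgue sets, which
    \<open>cut_norm\<close> admits; the change of variables uses the Borel map
    \<open>\<Psi>\<close>.\<close>
  define S' T' where "S' = \<phi> -` S \<inter> {0..1}" and "T' = \<phi> -` T \<inter> {0..1}"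
  have S'T': "S' \<in> sets (lebesgue_on {0..1})" "T' \<in> sets (lebesgue_on {0..1})"
    using measurable_sets [OF mp_bijection_measurable [OF \<phi>]] S T by (simp_all add: S'_def T'_def)
  let ?D = "\<lambda>p. ((\<chi> a. 1/3) - relabel W \<phi> p) $ a"
  have "(\<integral>p. g p \<partial>unit_meas2) = (\<integral>p. g (\<Psi> p) \<partial>unit_meas2)"
    using integral_distr [OF \<Psi> g] by (simp add: distr_\<Psi>)
  also have "\<dots> = set_lebesgue_integral lebesgue unit_square (\<lambda>p. indicator (S' \<times> T') p * ?D p)"
    unfolding unit_meas2_eq
  proof (rule set_integral_lebesgue_eq [symmetric])
    show "(\<lambda>p. g (\<Psi> p)) \<in> borel_measurable borel"
      using measurable_compose [OF \<Psi> g] by (simp add: measurable_cong_sets [OF sets_unit_meas2 refl])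
    have "AE p in unit_meas2. W (\<Psi> p) = V (\<Psi> p)"
      by (rule AE_distrD [OF \<Psi>]) (simp only: distr_\<Psi> ae)
    moreover have "AE p in unit_meas2. p \<in> unit_square"
      unfolding AE_unit_meas2_iff by simp
    ultimately show "AE p in density lborel (indicator unit_square). indicator (S' \<times> T') p * ?D p = g (\<Psi> p)"
      using AE_unit_meas2_prod [OF \<phi>\<psi>] unfolding unit_meas2_eq [symmetric]
    proof eventually_elim
      case (elim p)
      then have "\<Psi> p = (\<phi> (fst p), \<phi> (snd p))"
        by (simp add: \<Psi>_def case_prod_beta')
      with elim show ?case
        by (auto simp: g_def relabel_def S'_def T'_def split: split_indicator)
    qed
  qed (simp add: borel_Times)
  also have "\<dots> = set_lebesgue_integral lebesgue (S' \<times> T') ?D"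
    unfolding set_lebesgue_integral_def
    by (intro Bochner_Integration.integral_cong) (auto simp: S'_def T'_def split: split_indicator)
  also have "\<bar>\<dots>\<bar> \<le> cut_norm ?D"
    by (rule cut_norm_ge [of _ 1, OF graphon_difference_bound [OF const_prob_graphon [OF simplex3_third] W \<phi>] S'T'])
  finally show ?thesis unfolding g_def .
qed

text \<open>The density \<open>1 + f\<close> agrees with the product measure on rectangles, hence everywhere.\<close>

lemma AE_eq_0_if_rectangle_integrals_0:
  fixes f :: "real \<times> real \<Rightarrow> real"
  assumes f [measurable]: "f \<in> borel_measurable unit_meas2" and bound: "\<And>p. \<bar>f p\<bar> \<le> 1"
    and 0: "\<And>S T. S \<in> sets borel \<Longrightarrow> T \<in> sets borel \<Longrightarrow> (\<integral>p. indicator (S \<times> T) p * f p \<partial>unit_meas2) = 0"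
  shows "AE p in unit_meas2. f p = 0"
proof -
  have f1: "0 \<le> 1 + f p" for p
    using bound [of p] by linarith
  have "unit_meas2 = density unit_meas2 (\<lambda>p. ennreal (1 + f p))"
  proof (rule pair_measure_eqI)
    fix A B assume A: "A \<in> sets unit_meas" and B: "B \<in> sets unit_meas"
    then have AB [measurable]: "A \<times> B \<in> sets unit_meas2" by simp
    have int: "integrable unit_meas2 (\<lambda>p. indicator (A \<times> B) p * f p)"
      by (rule unit2.integrable_const_bound [of _ 1]) (auto simp: bound split: split_indicator)
    have ind: "integrable unit_meas2 (\<lambda>p. indicator (A \<times> B) p :: real)"
      by (rule integrable_real_indicator) (simp_all add: unit2.emeasure_eq_measure)
    have "emeasure (density unit_meas2 (\<lambda>p. ennreal (1 + f p))) (A \<times> B)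
      = (\<integral>\<^sup>+p. ennreal (indicator (A \<times> B) p + indicator (A \<times> B) p * f p) \<partial>unit_meas2)"
      by (subst emeasure_density) (auto intro!: nn_integral_cong split: split_indicator)
    also have "\<dots> = ennreal (\<integral>p. indicator (A \<times> B) p + indicator (A \<times> B) p * f p \<partial>unit_meas2)"
      by (rule nn_integral_eq_integral) (use int ind f1 in \<open>auto split: split_indicator\<close>)
    also have "\<dots> = ennreal (measure unit_meas2 (A \<times> B))"
      using int ind 0 [of A B] A B by (simp add: sets_unit_meas)
    also have "\<dots> = emeasure unit_meas A * emeasure unit_meas B"
      using unit.emeasure_pair_measure_Times [OF A B] by (simp add: unit2.emeasure_eq_measure)
    finally show "emeasure unit_meas A * emeasure unit_meas B
      = emeasure (density unit_meas2 (\<lambda>p. ennreal (1 + f p))) (A \<times> B)" ..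
  qed (simp_all add: unit.sigma_finite_measure_axioms)
  then have "density unit_meas2 (\<lambda>p. ennreal (1 + f p)) = density unit_meas2 (\<lambda>_. 1)"
    by (simp add: density_1)
  then have "AE p in unit_meas2. ennreal (1 + f p) = 1"
    by (intro unit2.density_unique) simp_all
  then show ?thesis
    by eventually_elim (use f1 in \<open>simp add: ennreal_eq_1\<close>)
qed

text \<open>Every rectangle integral of 1/3 - V in each colour is bounded by the cut distance, hence
  zero; it does not matter whether the infimum over relabellings is attained.\<close>

lemma cut_dist3_third_0_imp:
  assumes W: "W \<in> prob_graphons3" and dist: "cut_dist3 (\<lambda>_. \<chi> a. 1/3) W = 0"
  shows "AE p in unit_meas2. W p = (\<chi> a. 1/3)"
proof -
  obtain V where V: "V \<in> borel_measurable borel" "\<And>p. V p \<in> simplex3" "\<And>x y. V (x, y) = V (y, x)"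
    and ae: "AE p in unit_meas2. W p = V p"
    using prob_graphons3_borel_version [OF W] by blast
  have "AE p in unit_meas2. 1/3 - V p $ a = 0" for a
  proof (rule AE_eq_0_if_rectangle_integrals_0)
    show "(\<lambda>p. 1/3 - V p $ a) \<in> borel_measurable unit_meas2"
      using V(1) by (auto simp: borel_measurable_vec_iff measurable_cong_sets [OF sets_unit_meas2 refl]
          intro!: borel_measurable_diff)
    show "\<bar>1/3 - V p $ a\<bar> \<le> 1" for p
      using simplex3_deviation(1) [OF V(2), of p a] by linarith
    fix S T :: "real set" assume ST: "S \<in> sets borel" "T \<in> sets borel"
    let ?I = "\<bar>\<integral>p. indicator (S \<times> T) p * (1/3 - V p $ a) \<partial>unit_meas2\<bar>"
    have "?I \<le> cut_dist3 (\<lambda>_. \<chi> a. 1/3) W"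
      unfolding cut_dist3_def
    proof (rule cINF_greatest)
      fix \<phi> assume \<phi>: "\<phi> \<in> mp_bijections"
      show "?I \<le> cut_norm3 (\<lambda>p. (\<chi> a. 1/3) - relabel W \<phi> p)"
        using cut_norm_relabel_ge [OF W \<phi> V(1) ae ST]
          cut_norm_le_cut_norm3 [OF const_prob_graphon [OF simplex3_third] W \<phi>]
        by (rule order_trans)
    qed (use id_mp_bijection in auto)
    then show "(\<integral>p. indicator (S \<times> T) p * (1/3 - V p $ a) \<partial>unit_meas2) = 0"
      using dist by simp
  qed
  then have "AE p in unit_meas2. \<forall>a. 1/3 - V p $ a = 0"
    by (simp add: AE_all_countable)
  with ae show ?thesis
    by eventually_elim (simp add: vec_eq_iff)
qed

text \<open>Null sets are invisible to the cut norm, so W and the uniform graphon are equally far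
  from every U and have the same image under \<open>cut_equiv3\<close>.\<close>

lemma cut_class_third:
  assumes W: "W \<in> prob_graphons3" and ae: "AE p in unit_meas2. W p = (\<chi> a. 1/3)"
  shows "cut_equiv3 `` {W} = cut_equiv3 `` {\<lambda>_. \<chi> a. 1/3}"
proof -
  have "cut_dist3 W U = cut_dist3 (\<lambda>_. \<chi> a. 1/3) U" for U
  proof -
    have "cut_norm (\<lambda>p. (W p - relabel U \<phi> p) $ a) = cut_norm (\<lambda>p. ((\<chi> a. 1/3) - relabel U \<phi> p) $ a)" for \<phi> a
      by (rule cut_norm_cong_AE) (use ae in eventually_elim, simp)
    then show ?thesis
      unfolding cut_dist3_def cut_norm3_def by simp
  qed
  then show ?thesis
    using W const_prob_graphon [OF simplex3_third] by (auto simp: cut_equiv3_def)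
qed

theorem proposition3p39:
  fixes \<beta>\<^sub>4 :: real
  shows "(\<bar>\<beta>\<^sub>4\<bar> < 1 \<longrightarrow>
           psi_rb \<beta>\<^sub>4 = psi_rb_const \<beta>\<^sub>4
           \<and> (\<exists>!C. is_rb_maximizer \<beta>\<^sub>4 C)
           \<and> (\<forall>C. is_rb_maximizer \<beta>\<^sub>4 C \<longrightarrow> (\<exists>p\<in>simplex3. (\<lambda>_. p) \<in> C)))
       \<and> (\<beta>\<^sub>4 > B0 \<longrightarrow> psi_rb \<beta>\<^sub>4 > psi_rb_const \<beta>\<^sub>4)
       \<and> 14.0049634433 \<le> B0 \<and> B0 < 14.0049634434"
proof (intro conjI impI)
  show "14.0049634433 \<le> B0" "B0 < 14.0049634434"
    by (rule B0_bounds)+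
next
  assume \<beta>: "\<beta>\<^sub>4 > B0"
  then have "psi_rb_const \<beta>\<^sub>4 \<le> \<beta>\<^sub>4 / 27 + ln 3 / 2"
    using B0_bounds(1) by (intro psi_rb_const_le) simp
  also have "\<dots> < rb_functional \<beta>\<^sub>4 block_graphon"
    using \<beta> by (rule rb_functional_block_graphon_gt)
  also have "\<dots> \<le> psi_rb \<beta>\<^sub>4"
    unfolding psi_rb_eq by (rule cSUP_upper [OF block_graphon_in bdd_above_rb_functional])
  finally show "psi_rb \<beta>\<^sub>4 > psi_rb_const \<beta>\<^sub>4" .
next
  assume \<beta>: "\<bar>\<beta>\<^sub>4\<bar> < 1"
  let ?F = "rb_functional \<beta>\<^sub>4" and ?m = "\<beta>\<^sub>4 / 27 + ln 3 / 2"
  define c :: "real \<times> real \<Rightarrow> real^3" where "c = (\<lambda>_. \<chi> a. 1/3)"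
  have c: "c \<in> prob_graphons3"
    unfolding c_def by (rule const_prob_graphon [OF simplex3_third])
  have F_third: "?F W = ?m" if "AE p in unit_meas2. W p = (\<chi> a. 1/3)" for W
    using that by (rule rb_functional_AE_third)
  \<comment> \<open>For |beta| < 1 the coefficient of v in \<open>rb_functional_le\<close> is
    strictly negative, so equality forces v = 0.\<close>
  have F_le: "?F W \<le> ?m" and F_eq: "?F W = ?m \<Longrightarrow> AE p in unit_meas2. W p = (\<chi> a. 1/3)"
    if W: "W \<in> prob_graphons3" for W
  proof -
    obtain v where v: "0 \<le> v" "?F W \<le> ?m - 7/18 * (1 - \<bar>\<beta>\<^sub>4\<bar>) * v"
      "v = 0 \<Longrightarrow> AE p in unit_meas2. W p = (\<chi> a. 1/3)"
      using rb_functional_le [OF W] by metis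
    have "0 \<le> 7/18 * (1 - \<bar>\<beta>\<^sub>4\<bar>) * v"
      using v(1) \<beta> by simp
    then show "?F W \<le> ?m" using v(2) by linarith
    assume "?F W = ?m"
    then have "7/18 * (1 - \<bar>\<beta>\<^sub>4\<bar>) * v \<le> 0" using v(2) by linarith
    then have "v = 0"
      using v(1) \<beta> by (simp add: mult_le_0_iff)
    then show "AE p in unit_meas2. W p = (\<chi> a. 1/3)" by (rule v(3))
  qed
  have psi: "psi_rb \<beta>\<^sub>4 = ?m"
    unfolding psi_rb_eq
  proof (rule cSup_eq_maximum)
    have "?F c = ?m" unfolding c_def by (rule F_third) simp
    then show "?m \<in> ?F ` prob_graphons3" using c by (metis imageI)
  qed (use F_le in auto)
  have "psi_rb_const \<beta>\<^sub>4 = ?m"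
    unfolding psi_rb_const_eq
  proof (rule cSup_eq_maximum)
    have "?F (\<lambda>_. \<chi> a. 1/3) = ?m" by (rule F_third) simp
    then show "?m \<in> (\<lambda>p. ?F (\<lambda>_. p)) ` simplex3" using simplex3_third by (metis imageI)
  qed (use F_le const_prob_graphon in auto)
  with psi show "psi_rb \<beta>\<^sub>4 = psi_rb_const \<beta>\<^sub>4" by simp
  \<comment> \<open>Existence, uniqueness and constancy of the maximiser can all be read off this
    equivalence.\<close>
  have maximizer_iff: "is_rb_maximizer \<beta>\<^sub>4 C \<longleftrightarrow> C = cut_equiv3 `` {c}" for C
  proof
    assume C: "is_rb_maximizer \<beta>\<^sub>4 C"
    then obtain U where U: "U \<in> prob_graphons3" "C = cut_equiv3 `` {U}"
      by (auto simp: is_rb_maximizer_def graphon_classes3_def quotient_def)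
    then have "U \<in> C" by (auto simp: cut_equiv3_def cut_dist3_refl)
    then have "?F U = ?m"
      using C psi by (auto simp: is_rb_maximizer_def)
    then show "C = cut_equiv3 `` {c}"
      using U cut_class_third [OF U(1) F_eq [OF U(1)]] by (simp add: c_def)
  next
    assume C: "C = cut_equiv3 `` {c}"
    \<comment> \<open>A maximising class must attain the value at every representative. Here each
      one has cut distance 0 from the uniform graphon and so is uniform almost everywhere.\<close>
    have "?F W = ?m" if "W \<in> C" for W
      using that cut_dist3_third_0_imp [of W] F_third [of W] by (auto simp: C cut_equiv3_def c_def)
    moreover have "c \<in> C"
      using c by (auto simp: C cut_equiv3_def cut_dist3_refl)
    ultimately have "?F ` C = {?m}" by (auto intro: rev_image_eqI)
    moreover have "C \<in> graphon_classes3"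
      unfolding C graphon_classes3_def using c by (rule quotientI)
    ultimately show "is_rb_maximizer \<beta>\<^sub>4 C"
      by (simp add: is_rb_maximizer_def psi)
  qed
  show "\<exists>!C. is_rb_maximizer \<beta>\<^sub>4 C"
    unfolding maximizer_iff by simp
  have "c \<in> cut_equiv3 `` {c}"
    using c by (auto simp: cut_equiv3_def cut_dist3_refl)
  then show "\<forall>C. is_rb_maximizer \<beta>\<^sub>4 C \<longrightarrow> (\<exists>p\<in>simplex3. (\<lambda>_. p) \<in> C)"
    unfolding maximizer_iff c_def using simplex3_third by blast
qed

end
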